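(* Let $n\ge2$ and $\mu\in[0,1-\frac1n]$. Call a real number $\lambda$ a Lagrange multiplier (for the Kendall constraint) of problem (P) if there exist an $n\times n$ checkerboard copula $P=(p_{ij})$ with all entries strictly positive and $1-\mathrm{tr}(\Xi P\Xi P^\top)=\mu$, and vectors $\alpha,\beta\in\mathbb{R}^n$, such that for all $i,j\in\{1,\dots,n\}$ $$\log p_{ij}+1+\lambda\,(W\mathbf{p})_{ij}-\alpha_j-\beta_i=0 .$$ If every such Lagrange multiplier $\lambda$ satisfies $\lambda<2$, then problem (P) has a unique optimal solution.
   Context: An $n\times n$ checkerboard copula is a real $n\times n$ matrix with nonnegative entries whose row and column sums all equal $\frac1n$. $\Xi=(\xi_{ij})$ with $\xi_{ij}=1$ if $i=j$, $2$ if $i>j$, $0$ if $i<j$. Problem (P): minimize $I(P)=\sum_{i,j}p_{ij}\log p_{ij}$ (with $0\log0=0$) over $n\times n$ checkerboard copulas $P$ with $1-\mathrm{tr}(\Xi P\Xi P^\top)=\mu$. Here $\mathbf{p}=\mathrm{vec}(P)=(p_{11},p_{12},\dots,p_{1n},p_{21},\dots,p_{nn})^\top$ (row-major), $W=\frac12(\Xi\otimes\Xi^\top+\Xi^\top\otimes\Xi)\in\mathbb{R}^{n^2\times n^2}$ ($\otimes$ the Kronecker product), and $(W\mathbf{p})_{ij}$ denotes the entry of $W\mathbf{p}$ with index $n(i-1)+j$, i.e. $(W\mathbf{p})_{ij}=\frac12\sum_{a,b=1}^n(\xi_{ia}\xi_{bj}+\xi_{ai}\xi_{jb})p_{ab}$.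 *)

theory Defs
  imports Complex_Main
begin

text \<open>Matrices are functions nat => nat => real with indices in {1..n};
  entries outside {1..n} x {1..n} are required to be 0 so that the matrix is
  determined by its n x n block.\<close>

definition xi :: "nat \<Rightarrow> nat \<Rightarrow> real" where
  "xi i j = (if i = j then 1 else if i > j then 2 else 0)"

definition checkerboard_copula :: "nat \<Rightarrow> (nat \<Rightarrow> nat \<Rightarrow> real) \<Rightarrow> bool" where
  "checkerboard_copula n P \<longleftrightarrow>
     (\<forall>i j. (i \<notin> {1..n} \<or> j \<notin> {1..n}) \<longrightarrow> P i j = 0) \<and>
     (\<forall>i\<in>{1..n}. \<forall>j\<in>{1..n}. P i j \<ge> 0) \<and>
     (\<forall>i\<in>{1..n}. (\<Sum>j=1..n. P i j) = 1 / real n) \<and>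
     (\<forall>j\<in>{1..n}. (\<Sum>i=1..n. P i j) = 1 / real n)"

definition trace_XPXPt :: "nat \<Rightarrow> (nat \<Rightarrow> nat \<Rightarrow> real) \<Rightarrow> real" where
  "trace_XPXPt n P =
     (\<Sum>i=1..n. \<Sum>a=1..n. \<Sum>b=1..n. \<Sum>c=1..n. xi i a * P a b * xi b c * P i c)"

definition kendall_constraint :: "nat \<Rightarrow> real \<Rightarrow> (nat \<Rightarrow> nat \<Rightarrow> real) \<Rightarrow> bool" where
  "kendall_constraint n \<mu> P \<longleftrightarrow> 1 - trace_XPXPt n P = \<mu>"

definition Wp :: "nat \<Rightarrow> (nat \<Rightarrow> nat \<Rightarrow> real) \<Rightarrow> nat \<Rightarrow> nat \<Rightarrow> real" where
  "Wp n P i j = (1/2) * (\<Sum>a=1..n. \<Sum>b=1..n. (xi i a * xi b j + xi a i * xi j b) * P a b)"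

definition entropy_I :: "nat \<Rightarrow> (nat \<Rightarrow> nat \<Rightarrow> real) \<Rightarrow> real" where
  "entropy_I n P = (\<Sum>i=1..n. \<Sum>j=1..n. (if P i j = 0 then 0 else P i j * ln (P i j)))"

definition feasible_P :: "nat \<Rightarrow> real \<Rightarrow> (nat \<Rightarrow> nat \<Rightarrow> real) \<Rightarrow> bool" where
  "feasible_P n \<mu> P \<longleftrightarrow> checkerboard_copula n P \<and> kendall_constraint n \<mu> P"

definition optimal_P :: "nat \<Rightarrow> real \<Rightarrow> (nat \<Rightarrow> nat \<Rightarrow> real) \<Rightarrow> bool" where
  "optimal_P n \<mu> P \<longleftrightarrow> feasible_P n \<mu> P \<and>
     (\<forall>Q. feasible_P n \<mu> Q \<longrightarrow> entropy_I n P \<le> entropy_I n Q)"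

definition lagrange_multiplier :: "nat \<Rightarrow> real \<Rightarrow> real \<Rightarrow> bool" where
  "lagrange_multiplier n \<mu> lam \<longleftrightarrow>
     (\<exists>P (\<alpha>::nat \<Rightarrow> real) (\<beta>::nat \<Rightarrow> real).
        checkerboard_copula n P \<and> (\<forall>i\<in>{1..n}. \<forall>j\<in>{1..n}. P i j > 0) \<and>
        kendall_constraint n \<mu> P \<and>
        (\<forall>i\<in>{1..n}. \<forall>j\<in>{1..n}.
           ln (P i j) + 1 + lam * Wp n P i j - \<alpha> j - \<beta> i = 0))"

end

theory Submission
  imports Defs "HOL-Analysis.Analysis"
begin

text \<open>
  Writing \<open>\<Xi> = J + S\<close> with \<open>J\<close> the all-ones matrix and \<open>S\<close> the antisymmetric sign matrix, one finds
  \<open>W = J \<otimes> J - S \<otimes> S\<close>, so the constraint says that the quadratic form \<open>\<tau>(P)\<close> of \<open>S \<otimes> S\<close>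
  (Kendall's tau) equals \<open>\<mu>\<close>. An optimum exists by compactness.

  If \<open>\<mu> = 1 - 1/n\<close>, the diagonal copula \<open>M\<close> is the only feasible point. Otherwise, at any feasible \<open>P\<close>
  the derivative of \<open>\<tau>\<close> towards \<open>M\<close> is positive and towards the antidiagonal copula negative, because
  \<open>M\<close> has the largest distribution function of all copulas. Every small perturbation of \<open>P\<close> can thus be
  corrected to a feasible one; since \<open>x ln x\<close> has slope \<open>-\<infinity>\<close> at 0, an optimum has positive entries
  and satisfies the Lagrange condition with some \<open>\<lambda>\<close>. If \<open>\<lambda> < 0\<close>, then \<open>ln p\<close> would be strictly
  submodular, which forces \<open>\<tau>(P) < 0\<close>.

  For two optima \<open>P\<close>, \<open>Q\<close> and \<open>D = Q - P\<close>, the Lagrange condition and \<open>\<tau>(P) = \<tau>(Q)\<close> give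
  \<open>KL(Q|P) = (\<lambda>/2) \<tau>(D)\<close>. Pinsker's inequality bounds the left side below by half the square of the
  \<open>\<ell>\<^sup>1\<close>-norm of \<open>D\<close>, while \<open>\<tau>(D)\<close> is at most half that square because the rows of \<open>D\<close> sum to
  zero. With \<open>0 \<le> \<lambda> < 2\<close> this yields \<open>D = 0\<close>.
\<close>

declare One_nat_def [simp del]

subsection \<open>Kendall's tau as a quadratic form\<close>

definition sg :: "nat \<Rightarrow> nat \<Rightarrow> real" where
  "sg i j = sgn (real i - real j)"

definition frob :: "nat \<Rightarrow> (nat \<Rightarrow> nat \<Rightarrow> real) \<Rightarrow> (nat \<Rightarrow> nat \<Rightarrow> real) \<Rightarrow> real" where
  "frob n A B = (\<Sum>i=1..n. \<Sum>j=1..n. A i j * B i j)"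

text \<open>\<open>SPS n A\<close> is \<open>S A S\<^sup>T\<close>, and \<open>conc n\<close> is the bilinear form polarizing Kendall's tau.\<close>

definition SPS :: "nat \<Rightarrow> (nat \<Rightarrow> nat \<Rightarrow> real) \<Rightarrow> nat \<Rightarrow> nat \<Rightarrow> real" where
  "SPS n A i j = (\<Sum>a=1..n. \<Sum>b=1..n. sg i a * sg j b * A a b)"

definition conc :: "nat \<Rightarrow> (nat \<Rightarrow> nat \<Rightarrow> real) \<Rightarrow> (nat \<Rightarrow> nat \<Rightarrow> real) \<Rightarrow> real" where
  "conc n A B = frob n A (SPS n B)"

text \<open>Differences of two copulas are of this kind. Vanishing outside the block is not included
  and is assumed separately where it matters.\<close>

definition zero_margins :: "nat \<Rightarrow> (nat \<Rightarrow> nat \<Rightarrow> real) \<Rightarrow> bool" where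
  "zero_margins n d \<longleftrightarrow>
     (\<forall>i\<in>{1..n}. (\<Sum>j=1..n. d i j) = 0) \<and> (\<forall>j\<in>{1..n}. (\<Sum>i=1..n. d i j) = 0)"

lemma sg_swap: "sg i j = - sg j i"
  by (simp add: sg_def sgn_if)

lemma sg_self [simp]: "sg i i = 0"
  by (simp add: sg_def)

lemma abs_sg_le: "\<bar>sg i j\<bar> \<le> 1"
  by (simp add: sg_def sgn_if)

lemma xi_sg: "xi i j = 1 + sg i j"
  by (auto simp: xi_def sg_def sgn_if)

lemma conc_expand:
  "conc n A B = (\<Sum>i=1..n. \<Sum>j=1..n. \<Sum>a=1..n. \<Sum>b=1..n. sg i a * sg j b * A i j * B a b)"
  unfolding conc_def frob_def SPS_def sum_distrib_left
  by (intro sum.cong refl) (simp add: mult_ac)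

lemma sum4_swap:
  fixes f :: "nat \<Rightarrow> nat \<Rightarrow> nat \<Rightarrow> nat \<Rightarrow> real"
  shows "(\<Sum>i\<in>S. \<Sum>j\<in>S. \<Sum>a\<in>S. \<Sum>b\<in>S. f i j a b) = (\<Sum>i\<in>S. \<Sum>j\<in>S. \<Sum>a\<in>S. \<Sum>b\<in>S. f a b i j)"
proof -
  have pairs: "(\<Sum>i\<in>S. \<Sum>j\<in>S. g i j) = (\<Sum>u\<in>S\<times>S. g (fst u) (snd u))"
    for g :: "nat \<Rightarrow> nat \<Rightarrow> real"
    by (simp add: sum.cartesian_product case_prod_beta)
  show ?thesis unfolding pairs by (rule sum.swap)
qed

lemma member_le_sum2:
  fixes f :: "'a \<Rightarrow> 'b \<Rightarrow> real"
  assumes "finite S" "finite T" "i \<in> S" "j \<in> T"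
    and nn: "\<And>k l. k \<in> S \<Longrightarrow> l \<in> T \<Longrightarrow> 0 \<le> f k l"
  shows "f i j \<le> (\<Sum>k\<in>S. \<Sum>l\<in>T. f k l)"
proof -
  have "(\<lambda>u. f (fst u) (snd u)) (i, j) \<le> (\<Sum>u\<in>S \<times> T. f (fst u) (snd u))"
    using assms by (intro member_le_sum) auto
  then show ?thesis by (simp add: sum.cartesian_product case_prod_beta)
qed

text \<open>Exchanging the two index pairs transposes both sign factors, and the two minus signs
  cancel.\<close>

lemma conc_commute: "conc n A B = conc n B A"
proof -
  have "conc n A B = (\<Sum>i=1..n. \<Sum>j=1..n. \<Sum>a=1..n. \<Sum>b=1..n. sg a i * sg b j * A a b * B i j)"
    unfolding conc_expand by (rule sum4_swap)
  also have "\<dots> = conc n B A"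
    unfolding conc_expand
    by (intro sum.cong refl) (metis (no_types, opaque_lifting) sg_swap minus_mult_minus mult.commute mult.assoc)
  finally show ?thesis .
qed

lemma frob_add_left: "frob n (\<lambda>i j. A i j + B i j) C = frob n A C + frob n B C"
  by (simp add: frob_def distrib_right sum.distrib)

lemma frob_scale_left: "frob n (\<lambda>i j. c * A i j) C = c * frob n A C"
  by (simp add: frob_def sum_distrib_left mult_ac)

lemma conc_add_left: "conc n (\<lambda>i j. A i j + B i j) C = conc n A C + conc n B C"
  by (simp add: conc_def frob_add_left)

lemma conc_scale_left: "conc n (\<lambda>i j. c * A i j) C = c * conc n A C"
  by (simp add: conc_def frob_scale_left)

lemma conc_diff_left: "conc n (\<lambda>i j. A i j - B i j) C = conc n A C - conc n B C"
  using conc_add_left[of n A "\<lambda>i j. (-1) * B i j" C] conc_scale_left[of n "-1" B C] by simp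

lemma conc_add_right: "conc n C (\<lambda>i j. A i j + B i j) = conc n C A + conc n C B"
  using conc_add_left conc_commute by metis

lemma conc_scale_right: "conc n C (\<lambda>i j. c * A i j) = c * conc n C A"
  using conc_scale_left conc_commute by metis

lemma conc_diff_right: "conc n C (\<lambda>i j. A i j - B i j) = conc n C A - conc n C B"
  using conc_diff_left conc_commute by metis

lemmas conc_linear = conc_add_left conc_add_right conc_diff_left conc_diff_right
  conc_scale_left conc_scale_right

lemma copula_total:
  assumes "n \<ge> 1" "checkerboard_copula n P"
  shows "(\<Sum>i=1..n. \<Sum>j=1..n. P i j) = 1"
proof -
  have "(\<Sum>i=1..n. \<Sum>j=1..n. P i j) = (\<Sum>i=1..n. 1 / real n)"
    using assms(2) by (intro sum.cong) (auto simp: checkerboard_copula_def)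
  then show ?thesis using assms(1) by simp
qed

text \<open>The terms linear in \<open>sg\<close> cancel in the symmetrization because
  \<open>sg\<close> is antisymmetric; total mass 1 turns the constant part into 1.\<close>

lemma Wp_eq:
  assumes "n \<ge> 1" "checkerboard_copula n P"
  shows "Wp n P i j = 1 - SPS n P i j"
proof -
  have k: "xi i a * xi b j + xi a i * xi j b = 2 - 2 * (sg i a * sg j b)" for a b
    using sg_swap[of a i] sg_swap[of b j] by (simp add: xi_sg algebra_simps)
  have "Wp n P i j = (1/2) * (\<Sum>a=1..n. \<Sum>b=1..n. 2 * P a b - 2 * (sg i a * sg j b * P a b))"
    unfolding Wp_def k by (simp add: algebra_simps)
  also have "\<dots> = (\<Sum>a=1..n. \<Sum>b=1..n. P a b) - SPS n P i j"
    by (simp add: SPS_def sum_subtractf sum_distrib_left[symmetric])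
  finally show ?thesis using copula_total[OF assms] by simp
qed

text \<open>The trace is the quadratic form of an unsymmetrized Kronecker product. Exchanging the
  pairs \<open>(i, c)\<close> and \<open>(a, b)\<close> does not change it, so it may be averaged
  with its transpose.\<close>

lemma trace_eq_frob_Wp: "trace_XPXPt n P = frob n P (Wp n P)"
proof -
  define f where "f i c a b = xi i a * P a b * xi b c * P i c" for i c a b
  have t: "trace_XPXPt n P = (\<Sum>i=1..n. \<Sum>c=1..n. \<Sum>a=1..n. \<Sum>b=1..n. f i c a b)"
  proof -
    have "(\<Sum>a=1..n. \<Sum>b=1..n. \<Sum>c=1..n. f i c a b) = (\<Sum>c=1..n. \<Sum>a=1..n. \<Sum>b=1..n. f i c a b)" for i
    proof -
      have "(\<Sum>a=1..n. \<Sum>b=1..n. \<Sum>c=1..n. f i c a b) = (\<Sum>a=1..n. \<Sum>c=1..n. \<Sum>b=1..n. f i c a b)"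
        by (intro sum.cong refl sum.swap)
      also have "\<dots> = (\<Sum>c=1..n. \<Sum>a=1..n. \<Sum>b=1..n. f i c a b)"
        by (rule sum.swap)
      finally show ?thesis .
    qed
    then show ?thesis by (simp add: trace_XPXPt_def f_def)
  qed
  also have "\<dots> = (1/2) * ((\<Sum>i=1..n. \<Sum>c=1..n. \<Sum>a=1..n. \<Sum>b=1..n. f i c a b)
      + (\<Sum>i=1..n. \<Sum>c=1..n. \<Sum>a=1..n. \<Sum>b=1..n. f a b i c))"
    using sum4_swap[of f "{1..n}"] by simp
  also have "\<dots> = frob n P (Wp n P)"
    unfolding frob_def Wp_def sum.distrib[symmetric] sum_distrib_left
    by (intro sum.cong refl) (simp add: f_def algebra_simps)
  finally show ?thesis .
qed

lemma kendall_iff: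
  assumes "n \<ge> 1" "checkerboard_copula n P"
  shows "kendall_constraint n \<mu> P \<longleftrightarrow> conc n P P = \<mu>"
proof -
  have "trace_XPXPt n P = frob n P (\<lambda>i j. 1 - SPS n P i j)"
    unfolding trace_eq_frob_Wp using Wp_eq[OF assms] by (simp add: frob_def)
  also have "\<dots> = 1 - conc n P P"
    using copula_total[OF assms] by (simp add: conc_def frob_def algebra_simps sum_subtractf)
  finally show ?thesis by (simp add: kendall_constraint_def)
qed

subsection \<open>Bounds in terms of the total variation\<close>

text \<open>Since \<open>x\<close> sums to zero, \<open>h\<close> may be shifted by the midpoint of
  its range, after which it is bounded by half its oscillation.\<close>

lemma sum_zero_mult_le_oscillation:
  fixes x h :: "nat \<Rightarrow> real"
  assumes "finite S" and x: "sum x S = 0"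
    and h: "\<And>j k. j \<in> S \<Longrightarrow> k \<in> S \<Longrightarrow> h j - h k \<le> w"
  shows "\<bar>\<Sum>j\<in>S. x j * h j\<bar> \<le> (\<Sum>j\<in>S. \<bar>x j\<bar>) * w / 2"
proof (cases "S = {}")
  case False
  define c where "c = (Max (h ` S) + Min (h ` S)) / 2"
  have "Max (h ` S) \<in> h ` S" "Min (h ` S) \<in> h ` S"
    using assms(1) False by (auto intro!: Max_in Min_in)
  then have osc: "Max (h ` S) - Min (h ` S) \<le> w" using h by auto
  have hc: "\<bar>h j - c\<bar> \<le> w / 2" if "j \<in> S" for j
  proof -
    have "h j \<le> Max (h ` S)" "Min (h ` S) \<le> h j" using that assms(1) by auto
    then show ?thesis using osc unfolding c_def by (auto simp: abs_if field_simps)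
  qed
  have "(\<Sum>j\<in>S. x j * h j) = (\<Sum>j\<in>S. x j * (h j - c))"
    using x by (simp add: right_diff_distrib sum_subtractf sum_distrib_right[symmetric])
  also have "\<bar>\<dots>\<bar> \<le> (\<Sum>j\<in>S. \<bar>x j\<bar> * (w / 2))"
    by (rule order.trans[OF sum_abs]) (intro sum_mono, simp only: abs_mult, intro mult_left_mono hc, auto)
  finally show ?thesis by (simp add: sum_distrib_right sum_divide_distrib)
qed simp

lemma sum_zero_pos_part:
  fixes y :: "nat \<Rightarrow> real"
  assumes "sum y S = 0"
  shows "(\<Sum>b\<in>S. max (y b) 0) = (\<Sum>b\<in>S. \<bar>y b\<bar>) / 2"
proof -
  have "(\<Sum>b\<in>S. max (y b) 0) = (\<Sum>b\<in>S. (y b + \<bar>y b\<bar>) / 2)"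
    by (intro sum.cong refl) auto
  then show ?thesis using assms by (simp add: sum_divide_distrib[symmetric] sum.distrib)
qed

text \<open>For \<open>k \<le> j\<close> the coefficients \<open>sg j b - sg k b\<close> lie between
  0 and 2, so only the positive part of \<open>y\<close> counts, and it carries half of the absolute
  mass. The other case follows by negating \<open>y\<close>.\<close>

lemma sg_row_oscillation:
  fixes y :: "nat \<Rightarrow> real"
  assumes "sum y S = 0"
  shows "(\<Sum>b\<in>S. sg j b * y b) - (\<Sum>b\<in>S. sg k b * y b) \<le> (\<Sum>b\<in>S. \<bar>y b\<bar>)"
proof -
  have main: "(\<Sum>b\<in>S. (sg j b - sg k b) * y b) \<le> (\<Sum>b\<in>S. \<bar>y b\<bar>)"
    if "k \<le> j" "sum y S = 0" for j k and y :: "nat \<Rightarrow> real"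
  proof -
    have "(\<Sum>b\<in>S. (sg j b - sg k b) * y b) \<le> (\<Sum>b\<in>S. 2 * max (y b) 0)"
      using that(1) by (intro sum_mono) (auto simp: sg_def sgn_if max_def)
    also have "\<dots> = (\<Sum>b\<in>S. \<bar>y b\<bar>)"
      using sum_zero_pos_part[OF that(2)] by (simp add: sum_distrib_left[symmetric])
    finally show ?thesis .
  qed
  have "(\<Sum>b\<in>S. (sg j b - sg k b) * y b) \<le> (\<Sum>b\<in>S. \<bar>y b\<bar>)"
  proof (cases "k \<le> j")
    case True then show ?thesis using main assms by blast
  next
    case False
    then have "(\<Sum>b\<in>S. (sg k b - sg j b) * (- y b)) \<le> (\<Sum>b\<in>S. \<bar>- y b\<bar>)"
      using assms by (intro main) (auto simp: sum_negf)
    then show ?thesis by (simp add: algebra_simps)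
  qed
  then show ?thesis by (simp add: left_diff_distrib sum_subtractf)
qed

text \<open>Zero row sums gain the factor 1/2 over the trivial bound; it is what makes 2 the threshold for
  the multiplier.\<close>

lemma abs_conc_le:
  assumes "\<And>i. i \<in> {1..n} \<Longrightarrow> (\<Sum>j=1..n. d i j) = 0"
  shows "\<bar>conc n d d\<bar> \<le> (\<Sum>i=1..n. \<Sum>j=1..n. \<bar>d i j\<bar>)\<^sup>2 / 2"
proof -
  define r where "r i = (\<Sum>j=1..n. \<bar>d i j\<bar>)" for i
  define B where "B i a = (\<Sum>j=1..n. d i j * (\<Sum>b=1..n. sg j b * d a b))" for i a
  \<comment> \<open>Row \<open>i\<close> sums to zero, and the sign transform of row
    \<open>a\<close> oscillates by at most \<open>r a\<close>.\<close>
  have B: "\<bar>B i a\<bar> \<le> r i * r a / 2" if "i \<in> {1..n}" "a \<in> {1..n}" for i a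
    unfolding B_def r_def
    using that assms by (intro sum_zero_mult_le_oscillation sg_row_oscillation) auto
  have "conc n d d = (\<Sum>i=1..n. \<Sum>a=1..n. sg i a * B i a)"
  proof -
    have "conc n d d = (\<Sum>i=1..n. \<Sum>a=1..n. \<Sum>j=1..n. \<Sum>b=1..n. sg i a * sg j b * d i j * d a b)"
      unfolding conc_expand by (intro sum.cong refl sum.swap)
    then show ?thesis by (simp add: B_def sum_distrib_left mult_ac)
  qed
  also have "\<bar>\<dots>\<bar> \<le> (\<Sum>i=1..n. \<Sum>a=1..n. r i * r a / 2)"
  proof (intro order.trans[OF sum_abs] sum_mono)
    fix i a assume ia: "i \<in> {1..n}" "a \<in> {1..n}"
    have "\<bar>sg i a * B i a\<bar> \<le> 1 * \<bar>B i a\<bar>"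
      unfolding abs_mult by (intro mult_right_mono abs_sg_le) auto
    with B[OF ia] show "\<bar>sg i a * B i a\<bar> \<le> r i * r a / 2" by simp
  qed
  also have "\<dots> = (\<Sum>i=1..n. r i)\<^sup>2 / 2"
    by (simp add: power2_eq_square sum_product sum_divide_distrib)
  finally show ?thesis by (simp add: r_def)
qed

section \<open>Pinsker's inequality\<close>

text \<open>With \<open>x = q / p\<close> the difference of the two sides is \<open>q * h x\<close>.
  The derivative of \<open>h\<close> has the sign of \<open>x - 1\<close>, so \<open>h\<close> is
  minimal at 1, where it vanishes. The denominator \<open>q + 2 * p\<close> is chosen as a weight
  for Cauchy-Schwarz.\<close>

lemma pinsker_pointwise:
  fixes p q :: real
  assumes "p > 0" "q > 0"
  shows "3 * (q - p)\<^sup>2 / (2 * (q + 2 * p)) \<le> q * ln (q / p) - q + p"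
proof -
  define h where "h x = ln x - (x - 1) * (5 * x + 1) / (2 * x * (x + 2))" for x :: real
  have der: "(h has_real_derivative (x - 1)^3 / (x\<^sup>2 * (x + 2)\<^sup>2)) (at x)" if "x > 0" for x
    unfolding h_def
    using that
    apply (auto intro!: derivative_eq_intros)
    apply (simp add: divide_simps)
    apply (simp add: power2_eq_square power3_eq_cube algebra_simps)
    done
  have h0: "h x \<ge> 0" if "x > 0" for x
  proof (cases "x \<ge> 1")
    case True
    have "h 1 \<le> h x"
      using True by (intro DERIV_nonneg_imp_nondecreasing[of 1 x h])
        (auto intro!: exI[of _ "(_ - 1)^3 / (_\<^sup>2 * (_ + 2)\<^sup>2)"] der)
    then show ?thesis by (simp add: h_def)
  next
    case False
    have "h 1 \<le> h x"
    proof (rule DERIV_nonpos_imp_nonincreasing[of x 1 h])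
      fix y assume y: "x \<le> y" "y \<le> 1"
      have "(y - 1)^3 / (y\<^sup>2 * (y + 2)\<^sup>2) \<le> 0"
        using y that by (intro divide_nonpos_nonneg) (auto simp: power3_eq_cube mult_nonneg_nonpos)
      then show "\<exists>z. (h has_real_derivative z) (at y) \<and> z \<le> 0"
        using der[of y] y that by force
    qed (use False in auto)
    then show ?thesis by (simp add: h_def)
  qed
  define x where "x = q / p"
  have x: "x > 0" "q = x * p" using assms by (auto simp: x_def)
  have "q * ln (q / p) - q + p - 3 * (q - p)\<^sup>2 / (2 * (q + 2 * p)) = q * h x"
  proof -
    have e: "3 * (x * p - p)\<^sup>2 / (2 * (x * p + 2 * p)) = p * (3 * (x - 1)\<^sup>2 / (2 * (x + 2)))"
    proof -
      have "3 * (x * p - p)\<^sup>2 = p * (p * (3 * (x - 1)\<^sup>2))" "2 * (x * p + 2 * p) = p * (2 * (x + 2))"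
        by (simp_all add: power2_eq_square algebra_simps)
      then show ?thesis using assms by simp
    qed
    have "x * p * ln x - x * p + p - p * (3 * (x - 1)\<^sup>2 / (2 * (x + 2))) = x * p * h x"
      using assms x(1) unfolding h_def by (simp add: divide_simps) (simp add: power2_eq_square algebra_simps)
    then show ?thesis unfolding x(2) using assms e by simp
  qed
  moreover have "q * h x \<ge> 0" using h0[OF x(1)] assms by simp
  ultimately show ?thesis by linarith
qed

text \<open>Cauchy-Schwarz with the weights \<open>w\<close>: their total mass 3 matches the factor
  3 of the pointwise bound, and the terms \<open>- q u + p u\<close> cancel in the sum.\<close>

lemma pinsker:
  fixes p q :: "'a \<Rightarrow> real"
  assumes "finite S" and "\<And>u. u \<in> S \<Longrightarrow> p u > 0" "\<And>u. u \<in> S \<Longrightarrow> q u > 0"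
    and "sum p S = 1" "sum q S = 1"
  shows "(\<Sum>u\<in>S. \<bar>q u - p u\<bar>)\<^sup>2 / 2 \<le> (\<Sum>u\<in>S. q u * ln (q u / p u))"
proof -
  define w where "w u = q u + 2 * p u" for u
  have w: "w u > 0" if "u \<in> S" for u using assms that by (simp add: w_def add_pos_pos)
  have sw: "sum w S = 3" using assms by (simp add: w_def sum.distrib sum_distrib_left[symmetric])
  have "(\<Sum>u\<in>S. \<bar>q u - p u\<bar>) = (\<Sum>u\<in>S. (\<bar>q u - p u\<bar> / sqrt (w u)) * sqrt (w u))"
    using w by (intro sum.cong refl) force
  also have "\<dots>\<^sup>2 \<le> (\<Sum>u\<in>S. (\<bar>q u - p u\<bar> / sqrt (w u))\<^sup>2) * (\<Sum>u\<in>S. (sqrt (w u))\<^sup>2)"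
    by (rule Cauchy_Schwarz_ineq_sum)
  also have "(\<Sum>u\<in>S. (sqrt (w u))\<^sup>2) = 3"
    using w by (subst sw[symmetric], intro sum.cong) (auto simp: less_imp_le)
  also have "(\<Sum>u\<in>S. (\<bar>q u - p u\<bar> / sqrt (w u))\<^sup>2) = (\<Sum>u\<in>S. (q u - p u)\<^sup>2 / w u)"
    using w by (intro sum.cong refl) (auto simp: power_divide less_imp_le)
  finally have "(\<Sum>u\<in>S. \<bar>q u - p u\<bar>)\<^sup>2 / 2 \<le> (\<Sum>u\<in>S. 3 * (q u - p u)\<^sup>2 / (2 * w u))"
    by (simp add: sum_distrib_left sum_distrib_right sum_divide_distrib mult_ac)
  also have "\<dots> \<le> (\<Sum>u\<in>S. q u * ln (q u / p u) - q u + p u)"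
    unfolding w_def using assms by (intro sum_mono pinsker_pointwise) auto
  also have "\<dots> = (\<Sum>u\<in>S. q u * ln (q u / p u))"
    using assms by (simp add: sum.distrib sum_subtractf)
  finally show ?thesis .
qed

subsection \<open>Distribution functions and the extremal copulas\<close>

text \<open>The comonotone copula, whose distribution function is the Frechet-Hoeffding upper
  bound.\<close>

definition diag_copula :: "nat \<Rightarrow> nat \<Rightarrow> nat \<Rightarrow> real" where
  "diag_copula n i j = (if i = j \<and> i \<in> {1..n} then 1 / real n else 0)"

text \<open>Truncated subtraction is harmless in \<open>reflect\<close>: for \<open>j > n\<close> it refers to column 0, where copulas vanish.\<close>

definition reflect :: "nat \<Rightarrow> (nat \<Rightarrow> nat \<Rightarrow> real) \<Rightarrow> nat \<Rightarrow> nat \<Rightarrow> real" where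
  "reflect n P i j = P i (n + 1 - j)"

definition indep_copula :: "nat \<Rightarrow> nat \<Rightarrow> nat \<Rightarrow> real" where
  "indep_copula n i j = (if i \<in> {1..n} \<and> j \<in> {1..n} then 1 / (real n)\<^sup>2 else 0)"

text \<open>The distribution function. Indicators over the full block let it be combined term by
  term with \<open>xi\<close> and \<open>sg\<close>, and index 0 gives the value 0.\<close>

definition cum :: "nat \<Rightarrow> (nat \<Rightarrow> nat \<Rightarrow> real) \<Rightarrow> nat \<Rightarrow> nat \<Rightarrow> real" where
  "cum n D i j = (\<Sum>a=1..n. \<Sum>b=1..n. of_bool (a \<le> i) * of_bool (b \<le> j) * D a b)"

lemma copula_nonneg: "checkerboard_copula n P \<Longrightarrow> P i j \<ge> 0"
  unfolding checkerboard_copula_def by (metis order_refl)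

lemma copula_outside: "checkerboard_copula n P \<Longrightarrow> i \<notin> {1..n} \<or> j \<notin> {1..n} \<Longrightarrow> P i j = 0"
  unfolding checkerboard_copula_def by blast

lemma copula_row: "checkerboard_copula n P \<Longrightarrow> i \<in> {1..n} \<Longrightarrow> (\<Sum>j=1..n. P i j) = 1 / real n"
  unfolding checkerboard_copula_def by blast

lemma copula_col: "checkerboard_copula n P \<Longrightarrow> j \<in> {1..n} \<Longrightarrow> (\<Sum>i=1..n. P i j) = 1 / real n"
  unfolding checkerboard_copula_def by blast

lemma zero_margins_diff:
  "checkerboard_copula n P \<Longrightarrow> checkerboard_copula n Q \<Longrightarrow> zero_margins n (\<lambda>i j. Q i j - P i j)"
  by (auto simp: zero_margins_def sum_subtractf copula_row copula_col)

text \<open>Each \<open>xi i a\<close> is a sum of two indicators, which gives the four distribution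
  values. Since \<open>xi = 1 + sg\<close>, all terms other than the product of two signs contain a
  margin of \<open>D\<close> and vanish.\<close>

lemma SPS_cum:
  assumes D: "zero_margins n D" and "i \<ge> 1" "j \<ge> 1"
  shows "SPS n D i j = cum n D i j + cum n D (i - 1) j + cum n D i (j - 1) + cum n D (i - 1) (j - 1)"
proof -
  \<comment> \<open>For \<open>i = 0\<close> this would fail at \<open>a = 0\<close>, because of
    truncated subtraction.\<close>
  have x: "xi i a = of_bool (a \<le> i) + of_bool (a \<le> i - 1)" if "i \<ge> 1" for i a
    using that by (auto simp: xi_def)
  have "cum n D i j + cum n D (i - 1) j + cum n D i (j - 1) + cum n D (i - 1) (j - 1)
      = (\<Sum>a=1..n. \<Sum>b=1..n. xi i a * xi j b * D a b)"
    unfolding cum_def sum.distrib[symmetric] x[OF assms(2)] x[OF assms(3)]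
    by (intro sum.cong refl) (simp only: ring_distribs)
  also have "\<dots> = (\<Sum>a=1..n. \<Sum>b=1..n. sg i a * sg j b * D a b) + (\<Sum>a=1..n. \<Sum>b=1..n. (1 + sg i a) * D a b)
      + (\<Sum>a=1..n. \<Sum>b=1..n. sg j b * D a b)"
    unfolding sum.distrib[symmetric] xi_sg
    by (intro sum.cong refl) (simp add: algebra_simps)
  also have "(\<Sum>a=1..n. \<Sum>b=1..n. (1 + sg i a) * D a b) = 0"
    using D by (simp add: sum_distrib_left[symmetric] zero_margins_def)
  also have "(\<Sum>a=1..n. \<Sum>b=1..n. sg j b * D a b) = (\<Sum>b=1..n. \<Sum>a=1..n. sg j b * D a b)"
    by (rule sum.swap)
  also have "\<dots> = 0"
    using D by (simp add: sum_distrib_left[symmetric] zero_margins_def)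
  finally show ?thesis by (simp add: SPS_def)
qed

lemma cum_diff: "cum n (\<lambda>i j. A i j - B i j) i j = cum n A i j - cum n B i j"
  by (simp add: cum_def right_diff_distrib sum_subtractf)

lemma sum_of_bool_le: "i \<le> n \<Longrightarrow> (\<Sum>a=1..n. of_bool (a \<le> i) * c) = real i * c"
proof -
  assume "i \<le> n"
  then have "{1..n} \<inter> {a. a \<le> i} = {1..i}" by auto
  then have "(\<Sum>a=1..n. of_bool (a \<le> i) :: real) = real i"
    by (simp add: sum.If_cases of_bool_def)
  then show ?thesis by (simp add: sum_distrib_right[symmetric])
qed

lemma cum_diag:
  assumes "i \<le> n" "j \<le> n"
  shows "cum n (diag_copula n) i j = real (min i j) / real n"
proof -
  have "(\<Sum>b=1..n. of_bool (a \<le> i) * of_bool (b \<le> j) * diag_copula n a b)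
      = of_bool (a \<le> min i j) * (1 / real n)" if "a \<in> {1..n}" for a
  proof -
    have "(\<Sum>b=1..n. of_bool (a \<le> i) * of_bool (b \<le> j) * diag_copula n a b)
      = (\<Sum>b=1..n. if b = a then of_bool (a \<le> min i j) * (1 / real n) else 0)"
      using that by (intro sum.cong refl) (auto simp: diag_copula_def)
    then show ?thesis using that by simp
  qed
  then have "cum n (diag_copula n) i j = (\<Sum>a=1..n. of_bool (a \<le> min i j) * (1 / real n))"
    by (simp add: cum_def)
  also have "\<dots> = real (min i j) / real n"
    using assms by (subst sum_of_bool_le) auto
  finally show ?thesis .
qed

lemma cum_transpose: "cum n (\<lambda>i j. P j i) j i = cum n P i j"
  unfolding cum_def by (subst sum.swap) (simp add: mult_ac)

lemma copula_transpose: "checkerboard_copula n P \<Longrightarrow> checkerboard_copula n (\<lambda>i j. P j i)"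
  unfolding checkerboard_copula_def by auto

lemma cum_copula_le_row:
  assumes P: "checkerboard_copula n P" and "i \<le> n"
  shows "cum n P i j \<le> real i / real n"
proof -
  have "cum n P i j \<le> (\<Sum>a=1..n. \<Sum>b=1..n. of_bool (a \<le> i) * P a b)"
    unfolding cum_def using copula_nonneg[OF P] by (intro sum_mono) auto
  also have "\<dots> = (\<Sum>a=1..n. of_bool (a \<le> i) * (1 / real n))"
    by (simp only: sum_distrib_left[symmetric]) (intro sum.cong refl, simp only: copula_row[OF P])
  also have "\<dots> = real i / real n" using assms by (subst sum_of_bool_le) auto
  finally show ?thesis .
qed

text \<open>The mass at \<open>(i, j)\<close> belongs to the first \<open>i\<close> rows but lies
  beyond column \<open>k\<close>, so \<open>cum n P i k\<close> misses it.\<close>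

lemma cum_copula_less_row:
  assumes P: "checkerboard_copula n P" and "i \<in> {1..n}" "j \<in> {1..n}" "k < j" "P i j > 0"
  shows "cum n P i k < real i / real n"
proof -
  have "cum n P i k < (\<Sum>a=1..n. \<Sum>b=1..n. of_bool (a \<le> i) * P a b)"
    unfolding cum_def
  proof (rule sum_strict_mono_ex1)
    show "\<forall>a\<in>{1..n}. (\<Sum>b=1..n. of_bool (a \<le> i) * of_bool (b \<le> k) * P a b)
        \<le> (\<Sum>b=1..n. of_bool (a \<le> i) * P a b)"
      using copula_nonneg[OF P] by (intro ballI sum_mono) auto
    have "(\<Sum>b=1..n. of_bool (i \<le> i) * of_bool (b \<le> k) * P i b)
        < (\<Sum>b=1..n. of_bool (i \<le> i) * P i b)"
      using copula_nonneg[OF P] assms by (intro sum_strict_mono_ex1) (auto intro!: bexI[of _ j])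
    then show "\<exists>a\<in>{1..n}. (\<Sum>b=1..n. of_bool (a \<le> i) * of_bool (b \<le> k) * P a b)
        < (\<Sum>b=1..n. of_bool (a \<le> i) * P a b)"
      using assms(2) by blast
  qed auto
  also have "\<dots> = (\<Sum>a=1..n. of_bool (a \<le> i) * (1 / real n))"
    by (simp only: sum_distrib_left[symmetric]) (intro sum.cong refl, simp only: copula_row[OF P])
  also have "\<dots> = real i / real n" using assms by (subst sum_of_bool_le) auto
  finally show ?thesis .
qed

text \<open>The Frechet-Hoeffding bound; the column half is the row half of the transpose.\<close>

lemma cum_copula_le_diag:
  assumes P: "checkerboard_copula n P" and "i \<le> n" "j \<le> n"
  shows "cum n P i j \<le> cum n (diag_copula n) i j"
  using cum_copula_le_row[OF P assms(2), of j]
    cum_copula_le_row[OF copula_transpose[OF P] assms(3), of i] cum_transpose[of n P j i]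
  by (simp add: cum_diag assms min_def)

lemma diag_copula: "n \<ge> 1 \<Longrightarrow> checkerboard_copula n (diag_copula n)"
proof -
  assume "n \<ge> 1"
  have "(\<Sum>j=1..n. diag_copula n i j) = 1 / real n" "(\<Sum>j=1..n. diag_copula n j i) = 1 / real n"
    if "i \<in> {1..n}" for i
    using that by (auto simp: diag_copula_def if_distrib cong: if_cong)
  moreover have "diag_copula n i j \<ge> 0" "i \<notin> {1..n} \<or> j \<notin> {1..n} \<Longrightarrow> diag_copula n i j = 0" for i j
    by (auto simp: diag_copula_def)
  ultimately show ?thesis unfolding checkerboard_copula_def by blast
qed

lemma SPS_diag_diff_nonneg:
  assumes P: "checkerboard_copula n P" and ij: "i \<in> {1..n}" "j \<in> {1..n}"
  shows "SPS n (\<lambda>i j. diag_copula n i j - P i j) i j \<ge> 0"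
proof -
  have n: "n \<ge> 1" using ij by simp
  have zm: "zero_margins n (\<lambda>i j. diag_copula n i j - P i j)"
    by (rule zero_margins_diff[OF P diag_copula[OF n]])
  have n4: "i \<le> n" "j \<le> n" "i - 1 \<le> n" "j - 1 \<le> n" using ij by auto
  note le = cum_copula_le_diag[OF P n4(1,2)] cum_copula_le_diag[OF P n4(3,2)]
    cum_copula_le_diag[OF P n4(1,4)] cum_copula_le_diag[OF P n4(3,4)]
  show ?thesis using SPS_cum[OF zm, of i j] le ij by (simp add: cum_diff)
qed

text \<open>All four differences of distribution functions are nonnegative. Mass above the diagonal
  makes the row bound strict at \<open>(i, j - 1)\<close>, mass below it makes the column bound
  strict at \<open>(i - 1, j)\<close>.\<close>

lemma SPS_diag_diff_pos:
  assumes P: "checkerboard_copula n P" and ij: "i \<in> {1..n}" "j \<in> {1..n}" and "P i j > 0" "i \<noteq> j"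
  shows "SPS n (\<lambda>i j. diag_copula n i j - P i j) i j > 0"
proof -
  have n: "n \<ge> 1" using ij by simp
  have zm: "zero_margins n (\<lambda>i j. diag_copula n i j - P i j)"
    by (rule zero_margins_diff[OF P diag_copula[OF n]])
  have "cum n P i (j-1) < cum n (diag_copula n) i (j-1) \<or> cum n P (i-1) j < cum n (diag_copula n) (i-1) j"
  proof (cases "i < j")
    case True
    then have "min i (j - 1) = i" by auto
    then show ?thesis using cum_copula_less_row[OF P ij, of "j-1"] assms True by (simp add: cum_diag)
  next
    case False
    then have "min (i - 1) j = j" using assms by auto
    then show ?thesis
      using cum_copula_less_row[OF copula_transpose[OF P] ij(2,1), of "i-1"] assms False
        cum_transpose[of n P j "i-1"] by (simp add: cum_diag)
  qed
  moreover have n4: "i \<le> n" "j \<le> n" "i - 1 \<le> n" "j - 1 \<le> n" using ij by auto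
  note le = cum_copula_le_diag[OF P n4(1,2)] cum_copula_le_diag[OF P n4(3,2)]
    cum_copula_le_diag[OF P n4(1,4)] cum_copula_le_diag[OF P n4(3,4)]
  have "SPS n (\<lambda>i j. diag_copula n i j - P i j) i j = (cum n (diag_copula n) i j - cum n P i j)
      + (cum n (diag_copula n) (i-1) j - cum n P (i-1) j) + (cum n (diag_copula n) i (j-1) - cum n P i (j-1))
      + (cum n (diag_copula n) (i-1) (j-1) - cum n P (i-1) (j-1))"
    using SPS_cum[OF zm, of i j] ij by (simp add: cum_diff)
  ultimately show ?thesis using le by linarith
qed

lemma copula_eq_diag:
  assumes P: "checkerboard_copula n P" and off: "\<And>i j. i \<in> {1..n} \<Longrightarrow> j \<in> {1..n} \<Longrightarrow> i \<noteq> j \<Longrightarrow> P i j = 0"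
  shows "P = diag_copula n"
proof (intro ext)
  fix i j
  show "P i j = diag_copula n i j"
  proof (cases "i \<in> {1..n} \<and> j \<in> {1..n}")
    case True
    then have "(\<Sum>k=1..n. P i k) = (\<Sum>k=1..n. if k = i then P i i else 0)"
      using off by (intro sum.cong) auto
    then show ?thesis using True off copula_row[OF P, of i] by (auto simp: diag_copula_def)
  next
    case False
    then show ?thesis using copula_outside[OF P] by (auto simp: diag_copula_def)
  qed
qed

text \<open>By symmetry of \<open>conc\<close>, the entries of \<open>P\<close> are paired with the
  nonnegative matrix \<open>?E\<close>. A copula other than the diagonal one has mass at an
  off-diagonal cell, where \<open>?E\<close> is positive.\<close>

lemma conc_diag_diff_pos:
  assumes P: "checkerboard_copula n P" and "P \<noteq> diag_copula n"
  shows "conc n (\<lambda>i j. diag_copula n i j - P i j) P > 0"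
proof -
  obtain i j where ij: "i \<in> {1..n}" "j \<in> {1..n}" "i \<noteq> j" "P i j \<noteq> 0"
    using copula_eq_diag[OF P] assms(2) by blast
  then have pos: "P i j > 0" using copula_nonneg[OF P, of i j] by simp
  let ?E = "SPS n (\<lambda>i j. diag_copula n i j - P i j)"
  have nn: "P a b * ?E a b \<ge> 0" if "a \<in> {1..n}" "b \<in> {1..n}" for a b
    using SPS_diag_diff_nonneg[OF P that] copula_nonneg[OF P] by simp
  have "0 < P i j * ?E i j" using SPS_diag_diff_pos[OF P ij(1,2) pos ij(3)] pos by simp
  also have "\<dots> \<le> (\<Sum>a=1..n. \<Sum>b=1..n. P a b * ?E a b)"
    by (rule member_le_sum2[OF _ _ ij(1,2) nn]) auto
  finally show ?thesis by (subst conc_commute, unfold conc_def frob_def)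
qed

lemma conc_diag_diff_diag_nonneg:
  assumes P: "checkerboard_copula n P"
  shows "conc n (\<lambda>i j. diag_copula n i j - P i j) (diag_copula n) \<ge> 0"
  using SPS_diag_diff_nonneg[OF P]
  by (subst conc_commute, unfold conc_def frob_def, intro sum_nonneg mult_nonneg_nonneg)
    (simp_all add: diag_copula_def[of n])

text \<open>The \<open>n * (n - 1)\<close> ordered pairs of distinct diagonal cells are all
  concordant, each with weight \<open>1 / n\<^sup>2\<close>.\<close>

lemma conc_diag_diag: "n \<ge> 1 \<Longrightarrow> conc n (diag_copula n) (diag_copula n) = 1 - 1 / real n"
proof -
  assume n: "n \<ge> 1"
  have s: "SPS n (diag_copula n) i i = (\<Sum>a=1..n. (sg i a)\<^sup>2 / real n)" for i
  proof -
    have "(\<Sum>b=1..n. sg i a * sg i b * diag_copula n a b) = (sg i a)\<^sup>2 / real n" if "a \<in> {1..n}" for a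
    proof -
      have "(\<Sum>b=1..n. sg i a * sg i b * diag_copula n a b) =
          (\<Sum>b=1..n. if b = a then (sg i a)\<^sup>2 / real n else 0)"
        using that by (intro sum.cong refl) (auto simp: diag_copula_def power2_eq_square)
      then show ?thesis using that by simp
    qed
    then show ?thesis by (simp add: SPS_def)
  qed
  have sq: "(\<Sum>a=1..n. (sg i a)\<^sup>2 / real n) = 1 - 1 / real n" if "i \<in> {1..n}" for i
  proof -
    have "(\<Sum>a=1..n. (sg i a)\<^sup>2 / real n) = (\<Sum>a=1..n. 1 / real n - (if a = i then 1 / real n else 0))"
      by (intro sum.cong refl) (auto simp: sg_def sgn_if)
    then show ?thesis using that by (simp add: sum_subtractf)
  qed
  have "conc n (diag_copula n) (diag_copula n) =
      (\<Sum>i=1..n. \<Sum>j=1..n. if j = i then (1 / real n) * (1 - 1 / real n) else 0)"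
    unfolding conc_def frob_def
  proof (intro sum.cong refl)
    fix i j assume "i \<in> {1..n}" "j \<in> {1..n}"
    then show "diag_copula n i j * SPS n (diag_copula n) i j = (if j = i then (1 / real n) * (1 - 1 / real n) else 0)"
      using s[of i] sq[of i] by (auto simp: diag_copula_def)
  qed
  also have "\<dots> = 1 - 1 / real n" using n by simp
  finally show ?thesis .
qed

text \<open>With \<open>M\<close> the diagonal copula:
  \<open>conc n P P < conc n M P \<le> conc n M M\<close>. Hence the largest admissible
  \<open>\<mu>\<close> is attained only by \<open>M\<close>.\<close>

lemma conc_copula_less:
  assumes P: "checkerboard_copula n P" and "n \<ge> 1" and "P \<noteq> diag_copula n"
  shows "conc n P P < 1 - 1 / real n"
  using conc_diag_diff_pos[OF P assms(3)] conc_diag_diff_diag_nonneg[OF P] conc_diag_diag[OF assms(2)]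
    conc_commute[of n P "diag_copula n"]
  by (simp add: conc_linear)

section \<open>Column reversal and the antidiagonal copula\<close>

lemma sum_reflect:
  fixes f :: "nat \<Rightarrow> real"
  shows "(\<Sum>j=1..n. f (n + 1 - j)) = (\<Sum>j=1..n. f j)"
  using sum.atLeastAtMost_rev[of f 1 n] by (simp add: add.commute)

lemma reflect_copula:
  assumes P: "checkerboard_copula n P"
  shows "checkerboard_copula n (reflect n P)"
proof -
  have out: "n + 1 - j \<notin> {1..n}" if "j \<notin> {1..n}" for j using that by auto
  have ins: "n + 1 - j \<in> {1..n}" if "j \<in> {1..n}" for j using that by auto
  have "(\<Sum>j=1..n. P i (n + 1 - j)) = 1 / real n" if "i \<in> {1..n}" for i
    using copula_row[OF P that] by (simp only: sum_reflect)
  then show ?thesis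
    unfolding checkerboard_copula_def reflect_def
    using copula_nonneg[OF P] copula_outside[OF P] copula_col[OF P] out ins
    by blast
qed

text \<open>Reversing the columns negates every column sign and keeps the row signs, so concordance
  and discordance are exchanged.\<close>

lemma conc_reflect: "conc n (reflect n A) (reflect n B) = - conc n A B"
proof -
  have sgr: "sg (n + 1 - j) (n + 1 - b) = - sg j b" if "j \<in> {1..n}" "b \<in> {1..n}" for j b
    using that by (auto simp: sg_def sgn_if of_nat_diff)
  have S: "SPS n (reflect n B) i j = - SPS n B i (n + 1 - j)" if "j \<in> {1..n}" for i j
  proof -
    have "(\<Sum>b=1..n. sg i a * sg j b * reflect n B a b) = - (\<Sum>b=1..n. sg i a * sg (n + 1 - j) b * B a b)" for a
    proof -
      have "(\<Sum>b=1..n. sg i a * sg j b * reflect n B a b)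
          = (\<Sum>b=1..n. - (sg i a * sg (n + 1 - j) (n + 1 - b) * B a (n + 1 - b)))"
        using sgr[OF that] by (intro sum.cong refl) (simp add: reflect_def)
      also have "\<dots> = (\<Sum>b=1..n. - (sg i a * sg (n + 1 - j) b * B a b))"
        by (rule sum_reflect[where f = "\<lambda>b. - (sg i a * sg (n + 1 - j) b * B a b)"])
      finally show ?thesis by (simp add: sum_negf)
    qed
    then show ?thesis by (simp add: SPS_def sum_negf)
  qed
  have "conc n (reflect n A) (reflect n B) = (\<Sum>i=1..n. \<Sum>j=1..n. - (A i (n + 1 - j) * SPS n B i (n + 1 - j)))"
    unfolding conc_def frob_def by (intro sum.cong refl) (simp only: S reflect_def mult_minus_right)
  also have "\<dots> = (\<Sum>i=1..n. \<Sum>j=1..n. - (A i j * SPS n B i j))"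
    by (intro sum.cong refl sum_reflect)
  finally show ?thesis by (simp add: conc_def frob_def sum_negf)
qed

lemma conc_antidiag_diff_neg:
  assumes P: "checkerboard_copula n P" and "P \<noteq> reflect n (diag_copula n)"
  shows "conc n (\<lambda>i j. reflect n (diag_copula n) i j - P i j) P < 0"
proof -
  \<comment> \<open>The involution extends outside the block: columns 0 and \<open>n + 1\<close> are
    exchanged, later columns end up at \<open>n + 1\<close>, and \<open>P\<close> vanishes on all of
    them.\<close>
  have rr: "reflect n (reflect n P) = P"
  proof (intro ext)
    fix i j show "reflect n (reflect n P) i j = P i j"
      using copula_outside[OF P, of i j] copula_outside[OF P, of i "n + 1"] copula_outside[OF P, of i 0]
      by (cases "j \<le> n + 1") (auto simp: reflect_def)
  qed
  have "reflect n P \<noteq> diag_copula n" using assms(2) rr by metis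
  from conc_diag_diff_pos[OF reflect_copula[OF P] this]
  have "conc n (diag_copula n) (reflect n P) > conc n (reflect n P) (reflect n P)"
    by (simp add: conc_linear)
  then show ?thesis
    using conc_reflect[of n "diag_copula n" "reflect n P"] rr conc_reflect[of n P P]
    by (simp add: conc_linear)
qed

subsection \<open>First-order conditions at an optimum\<close>

lemma eventually_at_right_0:
  fixes c :: real
  assumes "c > 0"
  shows "\<forall>\<^sub>F t in at_right 0. 0 < t \<and> t < c"
  using assms by (intro eventually_at_rightI[of 0 c]) auto

text \<open>As a function of \<open>s\<close> the quadratic is nonpositive at 0 by assumption and
  nonnegative at \<open>s1\<close>, so it has a root in between.\<close>

lemma quadratic_correction:
  fixes a T b c v :: real
  assumes b: "b > 0"
  shows "\<exists>K>0. \<forall>\<^sub>F t in at_right 0. 2 * t * a + t\<^sup>2 * T \<le> 0 \<longrightarrow>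
    (\<exists>s\<ge>0. s \<le> K * (\<bar>a\<bar> * t + t\<^sup>2) \<and> 2 * t * a + t\<^sup>2 * T + 2 * s * b + 2 * t * s * c + s\<^sup>2 * v = 0)"
proof -
  \<comment> \<open>With this \<open>K\<close> the gain \<open>s1 * b\<close> outweighs
    \<open>2 * t * a + t\<^sup>2 * T\<close>. The slope in \<open>s\<close> starts at
    \<open>2 * b\<close>; the other \<open>b\<close> absorbs the terms with \<open>c\<close> and
    \<open>v\<close> once \<open>t\<close> is small.\<close>
  define K where "K = (2 + \<bar>T\<bar>) / b"
  have K: "K > 0" "K * b = 2 + \<bar>T\<bar>" using b by (auto simp: K_def)
  have "((\<lambda>t. 2 * t * \<bar>c\<bar> + K * (\<bar>a\<bar> * t + t\<^sup>2) * \<bar>v\<bar>) \<longlongrightarrow> 0) (at_right 0)"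
    by (auto intro!: tendsto_eq_intros)
  then have "\<forall>\<^sub>F t in at_right 0. 2 * t * \<bar>c\<bar> + K * (\<bar>a\<bar> * t + t\<^sup>2) * \<bar>v\<bar> < b"
    using b by (rule order_tendstoD)
  then have "\<forall>\<^sub>F t in at_right 0. 2 * t * a + t\<^sup>2 * T \<le> 0 \<longrightarrow>
    (\<exists>s\<ge>0. s \<le> K * (\<bar>a\<bar> * t + t\<^sup>2) \<and> 2 * t * a + t\<^sup>2 * T + 2 * s * b + 2 * t * s * c + s\<^sup>2 * v = 0)"
    using eventually_at_right_0[of 1, simplified]
  proof eventually_elim
    case (elim t)
    then have t: "t > 0" by simp
    define s1 where "s1 = K * (\<bar>a\<bar> * t + t\<^sup>2)"
    have s1: "s1 \<ge> 0" using K t by (simp add: s1_def)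
    define F where "F s = 2 * t * a + t\<^sup>2 * T + 2 * s * b + 2 * t * s * c + s\<^sup>2 * v" for s
    have "F s1 \<ge> 0"
    proof -
      have "2 * t * c \<ge> - (2 * t * \<bar>c\<bar>)"
        using abs_ge_minus_self[of "2 * t * c"] t unfolding abs_mult by simp
      moreover have "s1 * v \<ge> - (s1 * \<bar>v\<bar>)"
        using abs_ge_minus_self[of "s1 * v"] s1 unfolding abs_mult by simp
      ultimately have "b \<le> 2 * b + 2 * t * c + s1 * v" using elim unfolding s1_def by linarith
      then have "s1 * b \<le> s1 * (2 * b + 2 * t * c + s1 * v)" using s1 by (rule mult_left_mono)
      moreover have "s1 * b = (2 + \<bar>T\<bar>) * (\<bar>a\<bar> * t + t\<^sup>2)" using K(2) by (simp add: s1_def mult_ac)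
      moreover have "(2 + \<bar>T\<bar>) * (\<bar>a\<bar> * t + t\<^sup>2) \<ge> 2 * (\<bar>a\<bar> * t) + \<bar>T\<bar> * t\<^sup>2"
        using t by (simp add: algebra_simps)
      moreover have "2 * t * a \<ge> - (2 * (\<bar>a\<bar> * t))"
        using abs_ge_minus_self[of "2 * t * a"] t unfolding abs_mult by (simp add: mult_ac)
      moreover have "t\<^sup>2 * T \<ge> - (\<bar>T\<bar> * t\<^sup>2)"
        using abs_ge_minus_self[of "t\<^sup>2 * T"] unfolding abs_mult by (simp add: mult_ac)
      moreover have "F s1 = 2 * t * a + t\<^sup>2 * T + s1 * (2 * b + 2 * t * c + s1 * v)"
        by (simp add: F_def power2_eq_square algebra_simps)
      ultimately show ?thesis by linarith
    qed
    moreover have "continuous_on {0..s1} F" unfolding F_def by (intro continuous_intros)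
    ultimately have "\<exists>s. 0 \<le> s \<and> s \<le> s1 \<and> F s = 0" if "F 0 \<le> 0"
      using IVT'[of F 0 0 s1] that s1 by auto
    then show ?case by (auto simp: F_def s1_def)
  qed
  then show ?thesis using K(1) by blast
qed

text \<open>The correction \<open>s\<close> is of second order in \<open>t\<close> when \<open>d\<close> is tangent to the constraint, and of first order
  otherwise.\<close>

lemma kendall_correction:
  assumes P: "checkerboard_copula n P"
    and ne: "P \<noteq> diag_copula n" "P \<noteq> reflect n (diag_copula n)"
  shows "\<exists>K>0. \<forall>\<^sub>F t in at_right 0. \<exists>s R. R \<in> {diag_copula n, reflect n (diag_copula n)} \<and>
    0 \<le> s \<and> s \<le> K * (\<bar>conc n d P\<bar> * t + t\<^sup>2) \<and>
    conc n (\<lambda>i j. P i j + t * d i j + s * (R i j - P i j)) (\<lambda>i j. P i j + t * d i j + s * (R i j - P i j)) = conc n P P"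
proof -
  define e where "e R = (\<lambda>i j. R i j - P i j)" for R :: "nat \<Rightarrow> nat \<Rightarrow> real"
  define M where "M = diag_copula n"
  define W where "W = reflect n (diag_copula n)"
  have expand: "conc n (\<lambda>i j. P i j + t * d i j + s * e R i j) (\<lambda>i j. P i j + t * d i j + s * e R i j)
      = conc n P P + (2 * t * conc n d P + t\<^sup>2 * conc n d d + 2 * s * conc n (e R) P
         + 2 * t * s * conc n (e R) d + s\<^sup>2 * conc n (e R) (e R))" for s t R
    using conc_commute[of n P d] conc_commute[of n P "e R"] conc_commute[of n d "e R"]
    by (simp only: conc_add_left conc_add_right conc_scale_left conc_scale_right)
      (simp add: power2_eq_square algebra_simps)
  have bM: "conc n (e M) P > 0" unfolding e_def M_def by (rule conc_diag_diff_pos[OF P ne(1)])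
  have bW: "- conc n (e W) P > 0" using conc_antidiag_diff_neg[OF P ne(2)] by (simp add: e_def W_def)
  from quadratic_correction[OF bM, of "conc n d P" "conc n d d" "conc n (e M) d" "conc n (e M) (e M)"]
  obtain K1 where K1: "K1 > 0" and
    ev1: "\<forall>\<^sub>F t in at_right 0. 2 * t * conc n d P + t\<^sup>2 * conc n d d \<le> 0 \<longrightarrow>
      (\<exists>s\<ge>0. s \<le> K1 * (\<bar>conc n d P\<bar> * t + t\<^sup>2) \<and> 2 * t * conc n d P + t\<^sup>2 * conc n d d
        + 2 * s * conc n (e M) P + 2 * t * s * conc n (e M) d + s\<^sup>2 * conc n (e M) (e M) = 0)"
    by blast
  from quadratic_correction[OF bW, of "- conc n d P" "- conc n d d" "- conc n (e W) d" "- conc n (e W) (e W)"]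
  obtain K2 where K2: "K2 > 0" and
    ev2: "\<forall>\<^sub>F t in at_right 0. 2 * t * - conc n d P + t\<^sup>2 * - conc n d d \<le> 0 \<longrightarrow>
      (\<exists>s\<ge>0. s \<le> K2 * (\<bar>- conc n d P\<bar> * t + t\<^sup>2) \<and> 2 * t * - conc n d P + t\<^sup>2 * - conc n d d
        + 2 * s * - conc n (e W) P + 2 * t * s * - conc n (e W) d + s\<^sup>2 * - conc n (e W) (e W) = 0)"
    by blast
  define K where "K = max K1 K2"
  have "\<forall>\<^sub>F t in at_right 0. \<exists>s R. R \<in> {M, W} \<and>
    0 \<le> s \<and> s \<le> K * (\<bar>conc n d P\<bar> * t + t\<^sup>2) \<and>
    conc n (\<lambda>i j. P i j + t * d i j + s * e R i j) (\<lambda>i j. P i j + t * d i j + s * e R i j) = conc n P P"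
    using ev1 ev2 eventually_at_right_0[of 1, simplified]
  proof eventually_elim
    case (elim t)
    have q: "\<bar>conc n d P\<bar> * t + t\<^sup>2 \<ge> 0" using elim by simp
    have KK: "K1 * (\<bar>conc n d P\<bar> * t + t\<^sup>2) \<le> K * (\<bar>conc n d P\<bar> * t + t\<^sup>2)"
      "K2 * (\<bar>conc n d P\<bar> * t + t\<^sup>2) \<le> K * (\<bar>conc n d P\<bar> * t + t\<^sup>2)"
      using q by (auto simp: K_def intro!: mult_right_mono)
    show ?case
    \<comment> \<open>Too little concordance is repaired by moving towards \<open>M\<close>, too
      much by moving towards \<open>W\<close>, where the quadratic lemma is used with all
      coefficients negated.\<close>
    proof (cases "2 * t * conc n d P + t\<^sup>2 * conc n d d \<le> 0")
      case True
      then obtain s where s: "s \<ge> 0" "s \<le> K1 * (\<bar>conc n d P\<bar> * t + t\<^sup>2)"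
        "2 * t * conc n d P + t\<^sup>2 * conc n d d
        + 2 * s * conc n (e M) P + 2 * t * s * conc n (e M) d + s\<^sup>2 * conc n (e M) (e M) = 0"
        using elim by blast
      then show ?thesis unfolding expand using KK by (intro exI[of _ s] exI[of _ M]) auto
    next
      case False
      then have "2 * t * - conc n d P + t\<^sup>2 * - conc n d d \<le> 0" by simp
      then obtain s where s: "s \<ge> 0" "s \<le> K2 * (\<bar>- conc n d P\<bar> * t + t\<^sup>2)"
        "2 * t * - conc n d P + t\<^sup>2 * - conc n d d
        + 2 * s * - conc n (e W) P + 2 * t * s * - conc n (e W) d + s\<^sup>2 * - conc n (e W) (e W) = 0"
        using elim by blast
      then show ?thesis unfolding expand using KK by (intro exI[of _ s] exI[of _ W]) auto
    qed
  qed
  moreover have "K > 0" using K1 by (simp add: K_def)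
  ultimately show ?thesis unfolding e_def M_def W_def by blast
qed

section \<open>Tangent inequality and positivity of an optimum\<close>

text \<open>Convexity of \<open>x * ln x\<close>, with the tangent taken at the positive matrix
  \<open>X\<close> because \<open>P\<close> may have zero entries. The 1 in the slope
  \<open>ln x + 1\<close> drops out since both masses are 1.\<close>

lemma entropy_tangent:
  assumes P: "checkerboard_copula n P" and X: "checkerboard_copula n X"
    and pos: "\<And>i j. i \<in> {1..n} \<Longrightarrow> j \<in> {1..n} \<Longrightarrow> X i j > 0" and n: "n \<ge> 1"
  shows "entropy_I n X - entropy_I n P \<le> (\<Sum>i=1..n. \<Sum>j=1..n. ln (X i j) * (X i j - P i j))"
proof -
  have pt: "x * ln x - (if p = 0 then 0 else p * ln p) \<le> ln x * (x - p) + (x - p)"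
    if "x > 0" "p \<ge> 0" for x p :: real
  proof (cases "p = 0")
    case False
    then have "p > 0" using that by simp
    have "p * ln (x / p) \<le> p * (x / p - 1)"
      using that \<open>p > 0\<close> by (intro mult_left_mono ln_le_minus_one) auto
    then show ?thesis using that \<open>p > 0\<close> by (simp add: ln_div algebra_simps)
  qed (use that in simp)
  have "entropy_I n X - entropy_I n P
      = (\<Sum>i=1..n. \<Sum>j=1..n. X i j * ln (X i j) - (if P i j = 0 then 0 else P i j * ln (P i j)))"
  proof -
    have "entropy_I n X = (\<Sum>i=1..n. \<Sum>j=1..n. X i j * ln (X i j))"
      unfolding entropy_I_def by (intro sum.cong refl) auto
    then show ?thesis by (simp add: entropy_I_def sum_subtractf)
  qed
  also have "\<dots> \<le> (\<Sum>i=1..n. \<Sum>j=1..n. ln (X i j) * (X i j - P i j) + (X i j - P i j))"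
    using pos copula_nonneg[OF P] by (intro sum_mono pt) auto
  also have "\<dots> = (\<Sum>i=1..n. \<Sum>j=1..n. ln (X i j) * (X i j - P i j))"
    using copula_total[OF n P] copula_total[OF n X] by (simp add: sum.distrib sum_subtractf)
  finally show ?thesis .
qed

lemma optimal_tangent:
  assumes opt: "optimal_P n \<mu> P" and n: "n \<ge> 1" and X: "checkerboard_copula n X"
    and pos: "\<And>i j. i \<in> {1..n} \<Longrightarrow> j \<in> {1..n} \<Longrightarrow> X i j > 0" and XP: "conc n X X = conc n P P"
  shows "0 \<le> (\<Sum>i=1..n. \<Sum>j=1..n. ln (X i j) * (X i j - P i j))"
proof -
  have P: "checkerboard_copula n P" "kendall_constraint n \<mu> P"
    using opt by (auto simp: optimal_P_def feasible_P_def)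
  then have "feasible_P n \<mu> X"
    using X XP kendall_iff[OF n] by (auto simp: feasible_P_def)
  then have "entropy_I n P \<le> entropy_I n X" using opt by (auto simp: optimal_P_def)
  then show ?thesis using entropy_tangent[OF P(1) X pos n] by simp
qed

lemma copula_le_1:
  assumes P: "checkerboard_copula n P"
  shows "P i j \<le> 1"
proof (cases "i \<in> {1..n} \<and> j \<in> {1..n}")
  case True
  then have "P i j \<le> (\<Sum>j=1..n. P i j)" using copula_nonneg[OF P] by (intro member_le_sum) auto
  also have "\<dots> \<le> 1" using copula_row[OF P, of i] True by simp
  finally show ?thesis .
qed (use copula_outside[OF P] in auto)

lemma copula_convex3:
  assumes "checkerboard_copula n A" "checkerboard_copula n B" "checkerboard_copula n C"
    and "a \<ge> 0" "b \<ge> 0" "c \<ge> 0" "a + b + c = 1"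
  shows "checkerboard_copula n (\<lambda>i j. a * A i j + b * B i j + c * C i j)"
proof -
  have "a * (1 / real n) + b * (1 / real n) + c * (1 / real n) = 1 / real n"
    using assms(7) by (simp add: distrib_right[symmetric] del: times_divide_eq_right)
  then show ?thesis
    using assms unfolding checkerboard_copula_def
    by (simp add: sum.distrib sum_distrib_left[symmetric])
qed

lemma indep_copula: "n \<ge> 1 \<Longrightarrow> checkerboard_copula n (indep_copula n)"
  unfolding checkerboard_copula_def indep_copula_def by (auto simp: power2_eq_square)

text \<open>Moving by \<open>t\<close> towards the independence copula and correcting gives a
  positive feasible \<open>X\<close>. Entries positive in \<open>P\<close> cost at most a multiple
  of \<open>t\<close>, while a zero entry would gain a larger multiple of \<open>t\<close>, which
  contradicts \<open>optimal_tangent\<close>.\<close>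

lemma optimal_positive:
  assumes opt: "optimal_P n \<mu> P" and n: "n \<ge> 1"
    and ne: "P \<noteq> diag_copula n" "P \<noteq> reflect n (diag_copula n)"
    and kl: "k \<in> {1..n}" "l \<in> {1..n}"
  shows "P k l > 0"
proof (rule ccontr)
  assume "\<not> P k l > 0"
  have P: "checkerboard_copula n P" using opt by (auto simp: optimal_P_def feasible_P_def)
  have Pkl: "P k l = 0" using \<open>\<not> P k l > 0\<close> copula_nonneg[OF P, of k l] by simp
  define d where "d = (\<lambda>i j. indep_copula n i j - P i j)"
  define m where "m = 1 / (real n)\<^sup>2"
  have m: "m > 0" using n by (simp add: m_def)
  obtain K where K: "K > 0" and ev: "\<forall>\<^sub>F t in at_right 0. \<exists>s R. R \<in> {diag_copula n, reflect n (diag_copula n)} \<and>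
    0 \<le> s \<and> s \<le> K * (\<bar>conc n d P\<bar> * t + t\<^sup>2) \<and>
    conc n (\<lambda>i j. P i j + t * d i j + s * (R i j - P i j)) (\<lambda>i j. P i j + t * d i j + s * (R i j - P i j)) = conc n P P"
    using kendall_correction[OF P ne] by blast
  \<comment> \<open>Chosen so that \<open>t + s \<le> L * t\<close>, using
    \<open>t\<^sup>2 \<le> t\<close>.\<close>
  define L where "L = 1 + K * (\<bar>conc n d P\<bar> + 1)"
  have L: "L > 0" "L \<ge> 1" using K by (auto simp: L_def add_pos_nonneg)
  \<comment> \<open>\<open>t * c i j\<close> will bound the tangent term at \<open>(i, j)\<close>.
    Where \<open>P\<close> vanishes, 0 suffices because \<open>ln (X i j) \<le> 0\<close>.\<close>
  define c where "c i j = (if P i j = 0 then 0 else - ln (P i j / 2) * L)" for i j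
  have c0: "c i j \<ge> 0" for i j
    using copula_nonneg[OF P, of i j] copula_le_1[OF P, of i j] L
    by (auto simp: c_def mult_nonpos_nonneg)
  define C where "C = (\<Sum>i=1..n. \<Sum>j=1..n. c i j)"
  \<comment> \<open>The three bounds ensure in turn that \<open>t < 1\<close>, that \<open>P\<close>
    keeps weight at least 1/2 in \<open>X\<close>, and that
    \<open>ln (X k l) \<le> - (C + 1) / m\<close>.\<close>
  define t0 where "t0 = min 1 (min (1 / (2 * L)) (exp (- (C + 1) / m) / L))"
  have "t0 > 0" using L by (simp add: t0_def)
  from eventually_happens'[OF trivial_limit_at_right_real eventually_conj[OF ev eventually_at_right_0[OF this]]]
  obtain t s R where t: "0 < t" "t < t0" and R: "R \<in> {diag_copula n, reflect n (diag_copula n)}"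
    and s: "0 \<le> s" "s \<le> K * (\<bar>conc n d P\<bar> * t + t\<^sup>2)"
    and tau: "conc n (\<lambda>i j. P i j + t * d i j + s * (R i j - P i j)) (\<lambda>i j. P i j + t * d i j + s * (R i j - P i j)) = conc n P P"
    by blast
  have t1: "t < 1" "L * t < 1 / 2" "L * t < exp (- (C + 1) / m)"
    using t L by (auto simp: t0_def field_simps)
  have RC: "checkerboard_copula n R"
    using R diag_copula[OF n] reflect_copula by auto
  have sL: "t + s \<le> L * t"
  proof -
    have "t\<^sup>2 \<le> t" using t t1 by (simp add: power2_eq_square)
    then have "K * (\<bar>conc n d P\<bar> * t + t\<^sup>2) \<le> K * (\<bar>conc n d P\<bar> * t + t)"
      using K by simp
    then show ?thesis using s by (simp add: L_def algebra_simps)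
  qed
  define X where "X = (\<lambda>i j. (1 - t - s) * P i j + t * indep_copula n i j + s * R i j)"
  have Xeq: "X = (\<lambda>i j. P i j + t * d i j + s * (R i j - P i j))"
    by (simp add: X_def d_def algebra_simps)
  have X: "checkerboard_copula n X"
    unfolding X_def using t t1 s sL
    by (intro copula_convex3 P indep_copula[OF n] RC) auto
  have Xge: "X i j \<ge> t * m" "X i j \<ge> P i j / 2" if "i \<in> {1..n}" "j \<in> {1..n}" for i j
  proof -
    have "(1 - t - s) * P i j \<ge> (1/2) * P i j"
      using t1 sL copula_nonneg[OF P, of i j] by (intro mult_right_mono) auto
    moreover have "s * R i j \<ge> 0" using s copula_nonneg[OF RC, of i j] by simp
    moreover have "t * indep_copula n i j = t * m" using that by (simp add: indep_copula_def m_def)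
    moreover have "t * m > 0" using t m by simp
    ultimately show "X i j \<ge> t * m" "X i j \<ge> P i j / 2"
      using copula_nonneg[OF P, of i j] unfolding X_def by linarith+
  qed
  have Xpos: "X i j > 0" if "i \<in> {1..n}" "j \<in> {1..n}" for i j
    using Xge(1)[OF that] mult_pos_pos[OF t(1) m] by linarith
  have lnX: "ln (X i j) \<le> 0" if "i \<in> {1..n}" "j \<in> {1..n}" for i j
    using Xpos[OF that] copula_le_1[OF X] by simp
  have bound: "ln (X i j) * (X i j - P i j) \<le> t * c i j" if ij: "i \<in> {1..n}" "j \<in> {1..n}" for i j
  proof (cases "P i j = 0")
    case True
    then show ?thesis using lnX[OF ij] Xpos[OF ij] by (simp add: c_def mult_nonpos_nonneg)
  next
    case False
    then have Pp: "P i j > 0" using copula_nonneg[OF P, of i j] by simp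
    have "\<bar>X i j - P i j\<bar> \<le> L * t"
    proof -
      have "\<bar>X i j - P i j\<bar> \<le> \<bar>t * d i j\<bar> + \<bar>s * (R i j - P i j)\<bar>" unfolding Xeq by linarith
      also have "\<dots> = t * \<bar>d i j\<bar> + s * \<bar>R i j - P i j\<bar>" using t s by (simp add: abs_mult)
      also have "\<dots> \<le> t * 1 + s * 1"
        using t s copula_nonneg[OF P, of i j] copula_le_1[OF P, of i j]
          copula_nonneg[OF RC, of i j] copula_le_1[OF RC, of i j]
          copula_nonneg[OF indep_copula[OF n], of i j] copula_le_1[OF indep_copula[OF n], of i j]
        by (intro add_mono mult_left_mono) (auto simp: d_def)
      finally show ?thesis using sL by simp
    qed
    moreover have "\<bar>ln (X i j)\<bar> \<le> - ln (P i j / 2)"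
    proof -
      have "ln (P i j / 2) \<le> ln (X i j)" using Xge(2)[OF ij] Pp Xpos[OF ij] by simp
      then show ?thesis using lnX[OF ij] by simp
    qed
    ultimately have "\<bar>ln (X i j)\<bar> * \<bar>X i j - P i j\<bar> \<le> - ln (P i j / 2) * (L * t)"
      by (intro mult_mono) auto
    then show ?thesis using False by (simp add: c_def abs_mult[symmetric] mult_ac)
  qed
  \<comment> \<open>The entry is at least \<open>t * m\<close> and its logarithm at most
    \<open>- (C + 1) / m\<close>, so this one term outweighs the total cost \<open>t * C\<close> by
    \<open>t\<close>.\<close>
  have kl_bound: "ln (X k l) * (X k l - P k l) \<le> t * c k l - t * (C + 1)"
  proof -
    have "X k l \<le> t * 1 + s * 1"
      using t s copula_le_1[OF RC, of k l] copula_le_1[OF indep_copula[OF n], of k l]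
      unfolding X_def Pkl mult_zero_right add_0_left by (intro add_mono mult_left_mono) auto
    then have "X k l < exp (- (C + 1) / m)" using sL t1 by simp
    then have "ln (X k l) \<le> - (C + 1) / m"
      using Xpos[OF kl] ln_less_cancel_iff[of "X k l" "exp (- (C + 1) / m)"] by simp
    moreover have "C \<ge> 0" unfolding C_def using c0 by (intro sum_nonneg) auto
    then have neg: "- (C + 1) / m \<le> 0" using m by (intro divide_nonpos_pos) auto
    ultimately have "X k l * ln (X k l) \<le> X k l * (- (C + 1) / m)"
      using Xpos[OF kl] by (intro mult_left_mono) auto
    also have "\<dots> \<le> (t * m) * (- (C + 1) / m)"
      using Xge(1)[OF kl] neg by (rule mult_right_mono_neg)
    also have "\<dots> = t * (- (C + 1))" using m by simp
    finally show ?thesis using Pkl by (simp add: c_def algebra_simps)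
  qed
  have "(\<Sum>i=1..n. \<Sum>j=1..n. ln (X i j) * (X i j - P i j))
      \<le> (\<Sum>i=1..n. \<Sum>j=1..n. t * c i j - (if i = k \<and> j = l then t * (C + 1) else 0))"
    using bound kl_bound by (intro sum_mono) auto
  also have "\<dots> = t * C - (\<Sum>i=1..n. \<Sum>j=1..n. if i = k \<and> j = l then t * (C + 1) else 0)"
    by (simp add: sum_subtractf C_def sum_distrib_left)
  also have "(\<Sum>i=1..n. \<Sum>j=1..n. if i = k \<and> j = l then t * (C + 1) else 0)
      = (\<Sum>i=1..n. if i = k then t * (C + 1) else 0)"
    using kl by (intro sum.cong refl) auto
  also have "\<dots> = t * (C + 1)" using kl by simp
  finally have "(\<Sum>i=1..n. \<Sum>j=1..n. ln (X i j) * (X i j - P i j)) \<le> - t" by (simp add: algebra_simps)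
  moreover have "0 \<le> (\<Sum>i=1..n. \<Sum>j=1..n. ln (X i j) * (X i j - P i j))"
    using optimal_tangent[OF opt n X Xpos] tau unfolding Xeq by blast
  ultimately show False using t by simp
qed

section \<open>Stationarity\<close>

text \<open>For a tangent direction the correction is of order \<open>t\<^sup>2\<close>. It
  disappears when the tangent inequality is divided by \<open>t\<close> and \<open>t\<close> tends
  to 0.\<close>

lemma optimal_first_order:
  assumes opt: "optimal_P n \<mu> P" and n: "n \<ge> 1"
    and ne: "P \<noteq> diag_copula n" "P \<noteq> reflect n (diag_copula n)"
    and pos: "\<And>i j. i \<in> {1..n} \<Longrightarrow> j \<in> {1..n} \<Longrightarrow> P i j > 0"
    and d: "zero_margins n d" "\<And>i j. i \<notin> {1..n} \<or> j \<notin> {1..n} \<Longrightarrow> d i j = 0"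
    and d0: "conc n d P = 0"
  shows "frob n d (\<lambda>i j. ln (P i j)) \<ge> 0"
proof -
  have P: "checkerboard_copula n P" using opt by (auto simp: optimal_P_def feasible_P_def)
  obtain K where K: "K > 0" and ev: "\<forall>\<^sub>F t in at_right 0. \<exists>s R. R \<in> {diag_copula n, reflect n (diag_copula n)} \<and>
    0 \<le> s \<and> s \<le> K * t\<^sup>2 \<and>
    conc n (\<lambda>i j. P i j + t * d i j + s * (R i j - P i j)) (\<lambda>i j. P i j + t * d i j + s * (R i j - P i j)) = conc n P P"
    using kendall_correction[OF P ne, of d] d0 by auto
  \<comment> \<open>The choice depends on \<open>t\<close>, and \<open>R t\<close> may keep
    switching between the two extremal copulas; only the size of \<open>r\<close> enters the
    limits.\<close>
  then obtain s R where sR: "\<forall>\<^sub>F t in at_right 0. R t \<in> {diag_copula n, reflect n (diag_copula n)} \<and>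
    0 \<le> s t \<and> s t \<le> K * t\<^sup>2 \<and>
    conc n (\<lambda>i j. P i j + t * d i j + s t * (R t i j - P i j)) (\<lambda>i j. P i j + t * d i j + s t * (R t i j - P i j)) = conc n P P"
    unfolding eventually_ex by blast
  define r where "r t i j = s t * (R t i j - P i j)" for t i j
  define X where "X t = (\<lambda>i j. P i j + t * d i j + r t i j)" for t
  have RC: "checkerboard_copula n R'" if "R' \<in> {diag_copula n, reflect n (diag_copula n)}" for R'
    using that diag_copula[OF n] reflect_copula by auto
  have pos_t: "\<forall>\<^sub>F t in at_right 0. (t::real) > 0" by (simp add: eventually_at_right_less)
  have rt: "\<forall>\<^sub>F t in at_right 0. \<bar>r t i j / t\<bar> \<le> K * t" for i j
    using sR pos_t
  proof eventually_elim
    case (elim t)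
    then have Rt: "checkerboard_copula n (R t)" using RC by blast
    have "\<bar>R t i j - P i j\<bar> \<le> 1"
      using copula_nonneg[OF P, of i j] copula_le_1[OF P, of i j]
        copula_nonneg[OF Rt, of i j] copula_le_1[OF Rt, of i j] by linarith
    then have "\<bar>r t i j\<bar> \<le> (K * t\<^sup>2) * 1"
      unfolding r_def abs_mult using elim by (intro mult_mono) auto
    then show ?case using elim by (simp add: divide_simps power2_eq_square abs_mult)
  qed
  have rt0: "((\<lambda>t. r t i j / t) \<longlongrightarrow> 0) (at_right 0)" for i j
  proof (rule Lim_null_comparison[of _ "\<lambda>t. K * t"])
    show "\<forall>\<^sub>F t in at_right 0. norm (r t i j / t) \<le> K * t" using rt by simp
    show "((\<lambda>t. K * t) \<longlongrightarrow> 0) (at_right 0)" by (auto intro!: tendsto_eq_intros)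
  qed
  have quot: "((\<lambda>t. (X t i j - P i j) / t) \<longlongrightarrow> d i j) (at_right 0)" for i j
  proof -
    have "((\<lambda>t. d i j + r t i j / t) \<longlongrightarrow> d i j + 0) (at_right 0)"
      by (intro tendsto_intros rt0)
    then show ?thesis
      by (simp, elim Lim_transform_eventually)
        (use pos_t in \<open>eventually_elim, simp add: X_def field_simps\<close>)
  qed
  have Xlim: "((\<lambda>t. X t i j) \<longlongrightarrow> P i j) (at_right 0)" for i j
  proof -
    have "((\<lambda>t. P i j + t * ((X t i j - P i j) / t)) \<longlongrightarrow> P i j + 0 * d i j) (at_right 0)"
      by (intro tendsto_intros quot)
    then show ?thesis
      by (simp, elim Lim_transform_eventually) (use pos_t in \<open>eventually_elim, simp\<close>)
  qed
  have Xpos: "\<forall>\<^sub>F t in at_right 0. \<forall>i\<in>{1..n}. \<forall>j\<in>{1..n}. X t i j > 0"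
    using pos Xlim by (intro eventually_ball_finite ballI order_tendstoD(1)) auto
  have "\<forall>\<^sub>F t in at_right 0. 0 \<le> (\<Sum>i=1..n. \<Sum>j=1..n. ln (X t i j) * ((X t i j - P i j) / t))"
    using sR pos_t Xpos
  proof eventually_elim
    case (elim t)
    then have Rt: "checkerboard_copula n (R t)" using RC by blast
    have zr: "zero_margins n (\<lambda>i j. R t i j - P i j)" by (rule zero_margins_diff[OF P Rt])
    have Xt: "checkerboard_copula n (X t)"
      unfolding checkerboard_copula_def
    proof (intro conjI allI ballI impI)
      fix i j assume "i \<notin> {1..n} \<or> j \<notin> {1..n}"
      then have "d i j = 0" "P i j = 0" "R t i j = 0"
        using d(2) copula_outside[OF P] copula_outside[OF Rt] by blast+
      then show "X t i j = 0" by (simp add: X_def r_def)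
    next
      fix i j assume "i \<in> {1..n}" "j \<in> {1..n}" then show "X t i j \<ge> 0"
        using elim(3) less_imp_le by blast
    next
      fix i assume "i \<in> {1..n}" then show "(\<Sum>j=1..n. X t i j) = 1 / real n"
        using d(1) zr copula_row[OF P]
        by (simp add: X_def r_def sum.distrib sum_distrib_left[symmetric] zero_margins_def)
    next
      fix j assume "j \<in> {1..n}" then show "(\<Sum>i=1..n. X t i j) = 1 / real n"
        using d(1) zr copula_col[OF P]
        by (simp add: X_def r_def sum.distrib sum_distrib_left[symmetric] zero_margins_def)
    qed
    have "0 \<le> (\<Sum>i=1..n. \<Sum>j=1..n. ln (X t i j) * (X t i j - P i j))"
    proof (rule optimal_tangent[OF opt n Xt])
      show "X t i j > 0" if "i \<in> {1..n}" "j \<in> {1..n}" for i j using elim(3) that by blast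
      show "conc n (X t) (X t) = conc n P P" using elim(1) unfolding X_def r_def by blast
    qed
    then have "0 \<le> (\<Sum>i=1..n. \<Sum>j=1..n. ln (X t i j) * (X t i j - P i j)) / t"
      using elim(2) by simp
    then show ?case by (simp add: sum_divide_distrib)
  qed
  moreover have "((\<lambda>t. \<Sum>i=1..n. \<Sum>j=1..n. ln (X t i j) * ((X t i j - P i j) / t)) \<longlongrightarrow>
      (\<Sum>i=1..n. \<Sum>j=1..n. ln (P i j) * d i j)) (at_right 0)"
    by (intro tendsto_sum tendsto_mult tendsto_ln Xlim quot) (use pos in force)
  ultimately have "0 \<le> (\<Sum>i=1..n. \<Sum>j=1..n. ln (P i j) * d i j)"
    by (intro tendsto_lowerbound[of _ _ "at_right (0::real)"]) auto
  then show ?thesis by (simp add: frob_def mult.commute)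
qed

text \<open>An arbitrary \<open>d\<close> becomes tangent after adding the multiple \<open>q\<close>
  of the transversal direction \<open>e\<close>. Applying the first-order inequality to both signs
  of the result gives an equality, and the multiplier is read off from \<open>e\<close>.\<close>

lemma optimal_stationary:
  assumes opt: "optimal_P n \<mu> P" and n: "n \<ge> 1"
    and ne: "P \<noteq> diag_copula n" "P \<noteq> reflect n (diag_copula n)"
  shows "\<exists>lam. \<forall>d. zero_margins n d \<longrightarrow> (\<forall>i j. i \<notin> {1..n} \<or> j \<notin> {1..n} \<longrightarrow> d i j = 0) \<longrightarrow>
     frob n d (\<lambda>i j. ln (P i j)) = lam * conc n d P"
proof -
  have P: "checkerboard_copula n P" using opt by (auto simp: optimal_P_def feasible_P_def)
  let ?l = "\<lambda>i j. ln (P i j)"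
  note first = optimal_first_order[OF opt n ne optimal_positive[OF opt n ne]]
  define e where "e = (\<lambda>i j. diag_copula n i j - P i j)"
  define b where "b = conc n e P"
  have b: "b > 0" unfolding b_def e_def by (rule conc_diag_diff_pos[OF P ne(1)])
  have ze: "zero_margins n e" unfolding e_def by (rule zero_margins_diff[OF P diag_copula[OF n]])
  have oe: "e i j = 0" if "i \<notin> {1..n} \<or> j \<notin> {1..n}" for i j
    using that copula_outside[OF P, of i j] copula_outside[OF diag_copula[OF n], of i j] by (simp add: e_def)
  show ?thesis
  proof (intro exI[of _ "frob n e ?l / b"] allI impI)
    fix d assume d: "zero_margins n d" "\<forall>i j. i \<notin> {1..n} \<or> j \<notin> {1..n} \<longrightarrow> d i j = 0"
    define q where "q = - (conc n d P / b)"
    have main: "c * (frob n d ?l + q * frob n e ?l) \<ge> 0" for c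
    proof -
      have "frob n (\<lambda>i j. c * (d i j + q * e i j)) ?l \<ge> 0"
      proof (rule first)
        show "zero_margins n (\<lambda>i j. c * (d i j + q * e i j))"
          using d(1) ze by (simp add: zero_margins_def sum.distrib sum_distrib_left[symmetric])
        show "c * (d i j + q * e i j) = 0" if "i \<notin> {1..n} \<or> j \<notin> {1..n}" for i j
          using d(2) oe[OF that] that by simp
        show "conc n (\<lambda>i j. c * (d i j + q * e i j)) P = 0"
          using b by (simp only: conc_scale_left conc_add_left b_def[symmetric]) (simp add: q_def)
      qed
      then show ?thesis by (simp add: frob_scale_left frob_add_left)
    qed
    have "frob n d ?l + q * frob n e ?l = 0" using main[of 1] main[of "-1"] by simp
    then show "frob n d ?l = frob n e ?l / b * conc n d P" by (simp add: q_def mult_ac)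
  qed
qed

section \<open>The Lagrange multiplier and its sign\<close>

text \<open>Moving mass around a rectangle is the elementary margin-preserving direction; testing
  stationarity on it yields pointwise identities.\<close>

lemma mixed_difference:
  assumes mem: "i \<in> {1..n}" "j \<in> {1..n}" "a \<in> {1..n}" "b \<in> {1..n}"
  defines "d \<equiv> \<lambda>k l. (of_bool (k = i) - of_bool (k = a)) * (of_bool (l = j) - of_bool (l = b) :: real)"
  shows "zero_margins n d" "k \<notin> {1..n} \<or> l \<notin> {1..n} \<Longrightarrow> d k l = 0"
    "frob n d A = A i j - A i b - A a j + A a b"
proof -
  have delta: "(\<Sum>k=1..n. of_bool (k = i) * f k) = (f i :: real)" if "i \<in> {1..n}" for i f
  proof -
    have "(\<Sum>k=1..n. of_bool (k = i) * f k) = (\<Sum>k=1..n. if k = i then f i else 0)"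
      by (intro sum.cong) auto
    then show ?thesis using that by simp
  qed
  have s0: "(\<Sum>k=1..n. of_bool (k = i) - of_bool (k = a) :: real) = 0" "(\<Sum>k=1..n. of_bool (k = j) - of_bool (k = b) :: real) = 0"
    using delta[of _ "\<lambda>_. 1"] mem by (simp_all add: sum_subtractf)
  then show "zero_margins n d"
    unfolding d_def zero_margins_def by (simp add: sum_distrib_left[symmetric] sum_distrib_right[symmetric])
  show "d k l = 0" if "k \<notin> {1..n} \<or> l \<notin> {1..n}" using that mem by (auto simp: d_def)
  have inner: "(\<Sum>l=1..n. d k l * A k l) = (of_bool (k = i) - of_bool (k = a)) * (A k j - A k b)" for k
  proof -
    have "(\<Sum>l=1..n. d k l * A k l) = (of_bool (k = i) - of_bool (k = a)) *
        ((\<Sum>l=1..n. of_bool (l = j) * A k l) - (\<Sum>l=1..n. of_bool (l = b) * A k l))"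
      unfolding sum_subtractf[symmetric] sum_distrib_left d_def
      by (intro sum.cong refl) (simp only: left_diff_distrib mult.assoc)
    then show ?thesis using delta mem by simp
  qed
  have "frob n d A = (\<Sum>k=1..n. of_bool (k = i) * (A k j - A k b)) - (\<Sum>k=1..n. of_bool (k = a) * (A k j - A k b))"
    unfolding frob_def inner left_diff_distrib sum_subtractf ..
  also have "\<dots> = (A i j - A i b) - (A a j - A a b)"
    using mem by (subst (1 2) delta) auto
  finally show "frob n d A = A i j - A i b - A a j + A a b" by simp
qed

text \<open>The matrix with entries \<open>ln (P i j) - lam * SPS n P i j\<close> has vanishing
  mixed differences, hence splits into a row part and a column part. These are read off from the
  first column and row, with the corner subtracted once.\<close>

lemma stationary_imp_multiplier:
  assumes P: "checkerboard_copula n P" and n: "n \<ge> 1" and k: "kendall_constraint n \<mu> P"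
    and pos: "\<forall>i\<in>{1..n}. \<forall>j\<in>{1..n}. P i j > 0"
    and st: "\<And>i j a b. i \<in> {1..n} \<Longrightarrow> j \<in> {1..n} \<Longrightarrow> a \<in> {1..n} \<Longrightarrow> b \<in> {1..n} \<Longrightarrow>
      ln (P i j) - ln (P i b) - ln (P a j) + ln (P a b)
      = lam * (SPS n P i j - SPS n P i b - SPS n P a j + SPS n P a b)"
  shows "lagrange_multiplier n \<mu> lam"
proof -
  define \<alpha> where "\<alpha> j = ln (P 1 j) + 1 + lam * Wp n P 1 j" for j
  define \<beta> where "\<beta> i = ln (P i 1) + lam * Wp n P i 1 - ln (P 1 1) - lam * Wp n P 1 1" for i
  have "ln (P i j) + 1 + lam * Wp n P i j - \<alpha> j - \<beta> i = 0" if "i \<in> {1..n}" "j \<in> {1..n}" for i j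
    using st[of i j 1 1] that n unfolding \<alpha>_def \<beta>_def Wp_eq[OF n P] by (simp add: algebra_simps)
  then show ?thesis unfolding lagrange_multiplier_def using P k pos by blast
qed

text \<open>The mixed difference of the kernel factors into two increments of \<open>sg\<close>,
  both nonnegative, and the product is positive at the cell \<open>(i, j)\<close>.\<close>

lemma SPS_mixed_difference_pos:
  assumes mem: "i \<in> {1..n}" "j \<in> {1..n}" and lt: "i < a" "j < b"
    and pos: "\<And>i j. i \<in> {1..n} \<Longrightarrow> j \<in> {1..n} \<Longrightarrow> P i j > 0"
  shows "SPS n P i j - SPS n P i b - SPS n P a j + SPS n P a b > 0"
proof -
  let ?f = "\<lambda>k l. (sg a k - sg i k) * (sg b l - sg j l) * P k l"
  have nn: "?f k l \<ge> 0" if "k \<in> {1..n}" "l \<in> {1..n}" for k l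
    using pos[OF that] lt by (intro mult_nonneg_nonneg) (auto simp: sg_def sgn_if)
  have "0 < ?f i j" using pos[OF mem] lt by (simp add: sg_def)
  also have "\<dots> \<le> (\<Sum>k=1..n. \<Sum>l=1..n. ?f k l)"
    by (rule member_le_sum2[OF _ _ mem nn]) auto
  also have "\<dots> = SPS n P i j - SPS n P i b - SPS n P a j + SPS n P a b"
    unfolding SPS_def sum_subtractf[symmetric] sum.distrib[symmetric]
    by (intro sum.cong refl) (simp add: algebra_simps)
  finally show ?thesis .
qed

text \<open>Exchanging \<open>j\<close> and \<open>b\<close> negates \<open>sg j b\<close>; adding
  the two forms exposes the 2 by 2 minors of \<open>P\<close>.\<close>

lemma conc_antisymmetrized:
  "2 * conc n P P = (\<Sum>i=1..n. \<Sum>a=1..n. \<Sum>j=1..n. \<Sum>b=1..n.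
     sg i a * sg j b * (P i j * P a b - P i b * P a j))"
proof -
  have 1: "conc n P P = (\<Sum>i=1..n. \<Sum>a=1..n. \<Sum>j=1..n. \<Sum>b=1..n. sg i a * sg j b * (P i j * P a b))"
    unfolding conc_expand mult.assoc by (intro sum.cong refl sum.swap)
  also have "\<dots> = (\<Sum>i=1..n. \<Sum>a=1..n. \<Sum>j=1..n. \<Sum>b=1..n. sg i a * sg b j * (P i b * P a j))"
    by (intro sum.cong refl sum.swap)
  also have "\<dots> = (\<Sum>i=1..n. \<Sum>a=1..n. \<Sum>j=1..n. \<Sum>b=1..n. - (sg i a * sg j b * (P i b * P a j)))"
    by (intro sum.cong refl) (subst sg_swap, simp)
  finally have 2: "conc n P P = \<dots>" .
  have "2 * conc n P P = conc n P P + conc n P P" by simp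
  also have "\<dots> = (\<Sum>i=1..n. \<Sum>a=1..n. \<Sum>j=1..n. \<Sum>b=1..n. sg i a * sg j b * (P i j * P a b))
     + (\<Sum>i=1..n. \<Sum>a=1..n. \<Sum>j=1..n. \<Sum>b=1..n. - (sg i a * sg j b * (P i b * P a j)))"
    using 1 2 by (rule arg_cong2)
  finally show ?thesis unfolding sum.distrib[symmetric] by (simp add: algebra_simps)
qed

text \<open>For \<open>lam < 0\<close> all minors on increasing rows and columns would be negative.
  Each term of \<open>conc_antisymmetrized\<close> would then be nonpositive, and one strictly
  negative since \<open>n \<ge> 2\<close>, which contradicts \<open>tau\<close>.\<close>

lemma multiplier_nonneg:
  assumes n: "n \<ge> 2" and tau: "conc n P P \<ge> 0"
    and pos: "\<And>i j. i \<in> {1..n} \<Longrightarrow> j \<in> {1..n} \<Longrightarrow> P i j > 0"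
    and st: "\<And>i j a b. i \<in> {1..n} \<Longrightarrow> j \<in> {1..n} \<Longrightarrow> a \<in> {1..n} \<Longrightarrow> b \<in> {1..n} \<Longrightarrow>
      ln (P i j) - ln (P i b) - ln (P a j) + ln (P a b)
      = lam * (SPS n P i j - SPS n P i b - SPS n P a j + SPS n P a b)"
  shows "lam \<ge> 0"
proof (rule ccontr)
  assume "\<not> lam \<ge> 0"
  then have lam: "lam < 0" by simp
  have rr: "P i j * P a b < P i b * P a j"
    if m: "i \<in> {1..n}" "j \<in> {1..n}" "a \<in> {1..n}" "b \<in> {1..n}" and "i < a" "j < b" for i j a b
  proof -
    have p: "P i j > 0" "P a b > 0" "P i b > 0" "P a j > 0" using pos m by auto
    have "ln (P i j) - ln (P i b) - ln (P a j) + ln (P a b) < 0"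
      unfolding st[OF m] using lam SPS_mixed_difference_pos[OF m(1,2) that(5,6) pos]
      by (simp add: mult_neg_pos)
    then have "ln (P i j * P a b) < ln (P i b * P a j)" using p by (simp add: ln_mult)
    then show ?thesis using p by simp
  qed
  let ?g = "\<lambda>i a j b. sg i a * sg j b * (P i j * P a b - P i b * P a j)"
  have np: "?g i a j b \<le> 0" if m: "i \<in> {1..n}" "a \<in> {1..n}" "j \<in> {1..n}" "b \<in> {1..n}" for i a j b
  proof -
    consider "i = a \<or> j = b" | "i < a" "j < b" | "i < a" "b < j" | "a < i" "j < b" | "a < i" "b < j" by linarith
    then show ?thesis
    proof cases
      case 1 then show ?thesis by auto
    next
      case 2 then show ?thesis using rr[of i j a b] m by (simp add: sg_def mult.commute)
    next
      case 3 then show ?thesis using rr[of i b a j] m by (simp add: sg_def mult.commute)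
    next
      case 4 then show ?thesis using rr[of a j i b] m by (simp add: sg_def mult.commute)
    next
      case 5 then show ?thesis using rr[of a b i j] m by (simp add: sg_def mult.commute)
    qed
  qed
  have m2: "1 \<in> {1..n}" "2 \<in> {1..n}" using n by auto
  have neg: "?g 1 2 1 2 < 0" using rr[of 1 1 2 2] m2 by (simp add: sg_def)
  let ?h = "\<lambda>i a j b. - ?g i a j b"
  have h: "0 \<le> ?h i a j b" if "i \<in> {1..n}" "a \<in> {1..n}" "j \<in> {1..n}" "b \<in> {1..n}" for i a j b
    using np[OF that] by simp
  have "0 < ?h 1 2 1 2" using neg by simp
  also have "\<dots> \<le> (\<Sum>j=1..n. \<Sum>b=1..n. ?h 1 2 j b)"
    by (rule member_le_sum2[OF _ _ m2 h[OF m2]]) auto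
  also have "\<dots> \<le> (\<Sum>i=1..n. \<Sum>a=1..n. \<Sum>j=1..n. \<Sum>b=1..n. ?h i a j b)"
    by (rule member_le_sum2[OF _ _ m2, where f = "\<lambda>i a. \<Sum>j=1..n. \<Sum>b=1..n. ?h i a j b"])
      (auto intro!: sum_nonneg h simp del: minus_mult_right minus_mult_left neg_0_le_iff_le)
  also have "\<dots> = - (2 * conc n P P)"
    unfolding conc_antisymmetrized sum_negf ..
  finally show False using tau by simp
qed

section \<open>Comparison of two optima\<close>

lemma optimal_unique:
  assumes n: "n \<ge> 1" and P: "optimal_P n \<mu> P" and Q: "optimal_P n \<mu> Q"
    and Ppos: "\<And>i j. i \<in> {1..n} \<Longrightarrow> j \<in> {1..n} \<Longrightarrow> P i j > 0"
    and Qpos: "\<And>i j. i \<in> {1..n} \<Longrightarrow> j \<in> {1..n} \<Longrightarrow> Q i j > 0"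
    and st: "frob n (\<lambda>i j. Q i j - P i j) (\<lambda>i j. ln (P i j)) = lam * conc n (\<lambda>i j. Q i j - P i j) P"
    and lam: "0 \<le> lam" "lam < 2"
  shows "P = Q"
proof -
  have PC: "checkerboard_copula n P" "kendall_constraint n \<mu> P" and QC: "checkerboard_copula n Q" "kendall_constraint n \<mu> Q"
    using P Q by (auto simp: optimal_P_def feasible_P_def)
  have tau: "conc n P P = \<mu>" "conc n Q Q = \<mu>" using PC QC kendall_iff[OF n] by auto
  have ent: "entropy_I n P = entropy_I n Q"
    using P Q by (auto simp: optimal_P_def intro!: antisym)
  define d where "d = (\<lambda>i j. Q i j - P i j)"
  define N where "N = (\<Sum>i=1..n. \<Sum>j=1..n. \<bar>d i j\<bar>)"
  \<comment> \<open>Expand \<open>Q = P + d\<close> in the form and use that both points have the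
    same Kendall value.\<close>
  have dd: "conc n d d = - 2 * conc n d P"
    using tau conc_commute[of n P Q] by (simp add: d_def conc_linear)
  have zm: "zero_margins n d" unfolding d_def by (rule zero_margins_diff[OF PC(1) QC(1)])
  have bd: "conc n d d \<le> N\<^sup>2 / 2"
    using abs_conc_le[of n d] zm by (simp add: zero_margins_def N_def)
  define KL where "KL = (\<Sum>i=1..n. \<Sum>j=1..n. Q i j * ln (Q i j / P i j))"
  have "KL = (\<Sum>i=1..n. \<Sum>j=1..n. Q i j * ln (Q i j) - P i j * ln (P i j) - d i j * ln (P i j))"
    unfolding KL_def
  proof (intro sum.cong refl)
    fix i j assume "i \<in> {1..n}" "j \<in> {1..n}"
    then show "Q i j * ln (Q i j / P i j) = Q i j * ln (Q i j) - P i j * ln (P i j) - d i j * ln (P i j)"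
      using Ppos[of i j] Qpos[of i j] by (simp add: ln_div d_def algebra_simps)
  qed
  also have "\<dots> = entropy_I n Q - entropy_I n P - frob n d (\<lambda>i j. ln (P i j))"
  proof -
    have "entropy_I n P = (\<Sum>i=1..n. \<Sum>j=1..n. P i j * ln (P i j))" "entropy_I n Q = (\<Sum>i=1..n. \<Sum>j=1..n. Q i j * ln (Q i j))"
      unfolding entropy_I_def by (intro sum.cong refl; simp)+
    then show ?thesis by (simp add: frob_def sum_subtractf)
  qed
  \<comment> \<open>Equal entropies leave \<open>KL = - lam * conc n d P\<close>, and
    \<open>dd\<close> rewrites this in terms of \<open>conc n d d\<close>.\<close>
  finally have "KL = lam / 2 * conc n d d" using st ent dd by (simp add: d_def)
  also have "\<dots> \<le> lam / 2 * (N\<^sup>2 / 2)" using bd lam by (intro mult_left_mono) auto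
  finally have up: "KL \<le> lam / 2 * (N\<^sup>2 / 2)" .
  have low: "N\<^sup>2 / 2 \<le> KL"
  proof -
    let ?S = "{1..n} \<times> {1..n}"
    have sums: "(\<Sum>i=1..n. \<Sum>j=1..n. g i j) = (\<Sum>u\<in>?S. g (fst u) (snd u))" for g :: "nat \<Rightarrow> nat \<Rightarrow> real"
      by (simp add: sum.cartesian_product case_prod_beta)
    show ?thesis
      unfolding N_def KL_def d_def sums
      using copula_total[OF n PC(1)] copula_total[OF n QC(1)] Ppos Qpos
      unfolding sums by (intro pinsker) auto
  qed
  have "N = 0"
  proof (rule ccontr)
    assume "N \<noteq> 0"
    then have "lam / 2 * (N\<^sup>2 / 2) < 1 * (N\<^sup>2 / 2)" using lam by (intro mult_strict_right_mono) auto
    then show False using up low by simp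
  qed
  then have "\<forall>i\<in>{1..n}. (\<Sum>j=1..n. \<bar>d i j\<bar>) = 0"
    unfolding N_def by (subst (asm) sum_nonneg_eq_0_iff) (auto intro!: sum_nonneg)
  then have "d i j = 0" if "i \<in> {1..n}" "j \<in> {1..n}" for i j
    using that by (simp add: sum_nonneg_eq_0_iff)
  then have "P i j = Q i j" for i j
    using copula_outside[OF PC(1), of i j] copula_outside[OF QC(1), of i j]
    by (cases "i \<in> {1..n} \<and> j \<in> {1..n}") (auto simp: d_def)
  then show ?thesis by blast
qed

subsection \<open>Existence of an optimum\<close>

text \<open>The independence copula is invariant under column reversal, so its Kendall value equals
  its own negative.\<close>

lemma conc_indep: "conc n (indep_copula n) (indep_copula n) = 0"
proof -
  have "reflect n (indep_copula n) = indep_copula n"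
    by (intro ext) (auto simp: reflect_def indep_copula_def)
  then show ?thesis using conc_reflect[of n "indep_copula n" "indep_copula n"] by simp
qed

text \<open>Intermediate value theorem on the segment from the independence copula, with value 0, to
  the diagonal copula, with value \<open>1 - 1 / real n\<close>.\<close>

lemma feasible_exists:
  assumes n: "n \<ge> 1" and mu: "0 \<le> \<mu>" "\<mu> \<le> 1 - 1 / real n"
  shows "\<exists>P. feasible_P n \<mu> P"
proof -
  let ?A = "indep_copula n" and ?M = "diag_copula n"
  define X where "X t = (\<lambda>i j. (1 - t) * ?A i j + t * ?M i j)" for t
  have eq: "conc n (X t) (X t) = (1 - t) * (t * conc n ?A ?M) + t * ((1 - t) * conc n ?M ?A + t * (1 - 1 / real n))" for t
    unfolding X_def by (simp only: conc_add_left conc_add_right conc_scale_left conc_scale_right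
      conc_indep conc_diag_diag[OF n]) (simp add: algebra_simps)
  have "\<exists>t. 0 \<le> t \<and> t \<le> 1 \<and> conc n (X t) (X t) = \<mu>"
    unfolding eq using mu by (intro IVT') (auto intro!: continuous_intros)
  then obtain t where t: "0 \<le> t" "t \<le> 1" "conc n (X t) (X t) = \<mu>" by blast
  have "X t = (\<lambda>i j. (1 - t) * ?A i j + t * ?M i j + 0 * ?M i j)" by (simp add: X_def)
  then have "checkerboard_copula n (X t)"
    using t copula_convex3[OF indep_copula[OF n] diag_copula[OF n] diag_copula[OF n], of "1 - t" t 0] by simp
  then show ?thesis using t(3) kendall_iff[OF n] by (auto simp: feasible_P_def)
qed

text \<open>Tychonoff's theorem. For matrices it is applied twice, once for the rows and once for
  the entries of a row.\<close>

lemma compact_fun_box: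
  fixes S :: "'a \<Rightarrow> 'b :: topological_space set"
  assumes "\<And>i. compact (S i)"
  shows "compact {f. \<forall>i. f i \<in> S i}"
proof -
  have "compactin (product_topology (\<lambda>_::'a. euclidean) UNIV) (PiE UNIV S)"
    using assms by (simp add: compactin_PiE)
  moreover have "PiE UNIV S = {f. \<forall>i. f i \<in> S i}" by auto
  ultimately show ?thesis by (simp add: euclidean_product_topology)
qed

lemma continuous_on_x_ln_x: "continuous_on {0..1} (\<lambda>x::real. x * ln x)"
  unfolding continuous_on_def
proof
  fix x :: real assume x: "x \<in> {0..1}"
  show "((\<lambda>x. x * ln x) \<longlongrightarrow> x * ln x) (at x within {0..1})"
  proof (cases "x = 0")
    case True
    \<comment> \<open>Continuity at 0 comes from \<open>ln z \<le> z - 1\<close> at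
      \<open>z = 1 / sqrt y\<close>.\<close>
    have bd: "\<bar>y * ln y\<bar> \<le> 2 * sqrt y" if "y \<in> {0..1}" for y :: real
    proof (cases "y = 0")
      case False
      then have y: "0 < y" "y \<le> 1" using that by auto
      have "ln (1 / sqrt y) \<le> 1 / sqrt y - 1" using y by (intro ln_le_minus_one) auto
      then have "- ln y \<le> 2 * (1 / sqrt y)" using y by (simp add: ln_div ln_sqrt)
      then have "y * (- ln y) \<le> y * (2 * (1 / sqrt y))" using y by (intro mult_left_mono) auto
      also have "\<dots> = 2 * (y / sqrt y)" by simp
      also have "y / sqrt y = sqrt y" using y by (intro real_div_sqrt) simp
      finally show ?thesis using y mult_nonneg_nonpos[of y "ln y"] by simp
    qed simp
    have "((\<lambda>y. y * ln y) \<longlongrightarrow> 0) (at 0 within {0..1::real})"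
    proof (rule Lim_null_comparison[of _ "\<lambda>y. 2 * sqrt y"])
      show "\<forall>\<^sub>F y in at 0 within {0..1}. norm (y * ln y) \<le> 2 * sqrt y"
        using bd by (simp add: eventually_at_filter)
      show "((\<lambda>y. 2 * sqrt y) \<longlongrightarrow> 0) (at 0 within {0..1})"
        by (auto intro!: tendsto_eq_intros)
    qed
    then show ?thesis using True by simp
  next
    case False
    then show ?thesis by (intro tendsto_mult tendsto_ln tendsto_ident_at)
  qed
qed

text \<open>The feasible set is closed in the product topology and lies in a compact box, because
  copula entries are between 0 and 1; the objective is continuous there.\<close>

lemma optimal_exists:
  assumes "\<exists>P. feasible_P n \<mu> P"
  shows "\<exists>P. optimal_P n \<mu> P"
proof -
  let ?box = "{P. \<forall>i. P i \<in> {f. \<forall>j. f j \<in> {0..1}}} :: (nat \<Rightarrow> nat \<Rightarrow> real) set"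
  let ?F = "{P. feasible_P n \<mu> P}"
  have coord: "continuous_on S (\<lambda>P. P i j)" for S :: "(nat \<Rightarrow> nat \<Rightarrow> real) set" and i j
  proof -
    have "continuous_on S (\<lambda>P::nat \<Rightarrow> nat \<Rightarrow> real. P i)"
      using continuous_on_product_then_coordinatewise[of S "\<lambda>P. P" i] by simp
    then show ?thesis by (rule continuous_on_product_then_coordinatewise)
  qed
  have "compact ?box" by (intro compact_fun_box compact_Icc)
  moreover have "closed ?F"
    unfolding feasible_P_def checkerboard_copula_def kendall_constraint_def trace_XPXPt_def Ball_def
    by (intro closed_Collect_conj closed_Collect_all closed_Collect_imp open_Collect_const
        closed_Collect_eq closed_Collect_le continuous_on_sum continuous_on_mult
        continuous_on_diff continuous_on_const coord)
  moreover have sub: "?F \<subseteq> ?box"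
    using copula_nonneg copula_le_1 by (auto simp: feasible_P_def)
  ultimately have "compact ?F" by (metis compact_Int_closed inf.absorb_iff2)
  moreover have "continuous_on ?F (entropy_I n)"
  proof -
    have e: "entropy_I n = (\<lambda>P. \<Sum>i=1..n. \<Sum>j=1..n. P i j * ln (P i j))"
      unfolding entropy_I_def by (intro ext sum.cong refl) auto
    have "continuous_on ?F (\<lambda>P. P i j * ln (P i j))" for i j
      using sub by (intro continuous_on_compose2[OF continuous_on_x_ln_x coord]) auto
    then show ?thesis unfolding e by (intro continuous_on_sum)
  qed
  ultimately show ?thesis
    using continuous_attains_inf[of ?F "entropy_I n"] assms by (auto simp: optimal_P_def)
qed

section \<open>Existence and uniqueness combined\<close>

theorem theorem4:
  fixes n :: nat and \<mu> :: real
  assumes "n \<ge> 2"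
    and "0 \<le> \<mu>" and "\<mu> \<le> 1 - 1 / real n"
    and "\<forall>lam. lagrange_multiplier n \<mu> lam \<longrightarrow> lam < 2"
  shows "\<exists>!P. optimal_P n \<mu> P"
proof -
  have n: "n \<ge> 1" using assms(1) by simp
  obtain P where P: "optimal_P n \<mu> P"
    using optimal_exists[OF feasible_exists[OF n assms(2,3)]] by blast
  have copula: "checkerboard_copula n Q" "kendall_constraint n \<mu> Q" "conc n Q Q = \<mu>" if "optimal_P n \<mu> Q" for Q
    using that kendall_iff[OF n] by (auto simp: optimal_P_def feasible_P_def)
  have "P = Q" if Q: "optimal_P n \<mu> Q" for Q
  proof (cases "\<mu> = 1 - 1 / real n")
    case True
    then show ?thesis
      using conc_copula_less[OF _ n, of P] conc_copula_less[OF _ n, of Q] copula[OF P] copula[OF Q] by auto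
  next
    case False
    \<comment> \<open>The extremal copulas have Kendall values \<open>1 - 1 / real n\<close>,
      excluded in this case, and its negative, excluded by \<open>0 \<le> \<mu>\<close> and
      \<open>n \<ge> 2\<close>.\<close>
    have ne: "R \<noteq> diag_copula n" "R \<noteq> reflect n (diag_copula n)" if "optimal_P n \<mu> R" for R
    proof -
      show "R \<noteq> diag_copula n" using copula(3)[OF that] conc_diag_diag[OF n] False by auto
      have "1 - 1 / real n > 0" using assms(1) by simp
      then have "conc n (reflect n (diag_copula n)) (reflect n (diag_copula n)) < 0"
        using conc_diag_diag[OF n] by (simp add: conc_reflect)
      then show "R \<noteq> reflect n (diag_copula n)" using copula(3)[OF that] assms(2) by auto
    qed
    note Ppos = optimal_positive[OF P n ne[OF P]]
    note Qpos = optimal_positive[OF Q n ne[OF Q]]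
    obtain lam where st: "\<And>d. zero_margins n d \<Longrightarrow> (\<And>i j. i \<notin> {1..n} \<or> j \<notin> {1..n} \<Longrightarrow> d i j = 0) \<Longrightarrow>
        frob n d (\<lambda>i j. ln (P i j)) = lam * conc n d P"
      using optimal_stationary[OF P n ne[OF P]] by blast
    have mixed: "ln (P i j) - ln (P i b) - ln (P a j) + ln (P a b)
        = lam * (SPS n P i j - SPS n P i b - SPS n P a j + SPS n P a b)"
      if "i \<in> {1..n}" "j \<in> {1..n}" "a \<in> {1..n}" "b \<in> {1..n}" for i j a b
      using st[OF mixed_difference(1,2)[OF that]] unfolding conc_def mixed_difference(3)[OF that] .
    have "lagrange_multiplier n \<mu> lam"
      using stationary_imp_multiplier[OF copula(1)[OF P] n copula(2)[OF P]] Ppos mixed by blast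
    then have "lam < 2" using assms(4) by blast
    moreover have "lam \<ge> 0"
      using multiplier_nonneg[OF assms(1) _ Ppos mixed] copula(3)[OF P] assms(2) by simp
    moreover have "frob n (\<lambda>i j. Q i j - P i j) (\<lambda>i j. ln (P i j)) = lam * conc n (\<lambda>i j. Q i j - P i j) P"
      using copula_outside[OF copula(1)[OF P]] copula_outside[OF copula(1)[OF Q]]
      by (intro st zero_margins_diff copula(1) P Q) simp
    ultimately show ?thesis using optimal_unique[OF n P Q Ppos Qpos] by blast
  qed
  then show ?thesis using P by blast
qed

end
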